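(* Assume the Continuum Hypothesis. Let $K$ and $S$ be two compact spaces with empty $\omega$-derived set, i.e. $K^{\omega}=\emptyset$ and $S^{\omega}=\emptyset$, and suppose that $K$ is nonmetrizable. Then $\operatorname{Ext}(C(K),C(S))\neq 0$.
   Context: Compact spaces are understood to be Hausdorff. For a compact space $K$, $C(K)$ is the Banach space of scalar continuous functions on $K$ with the supremum norm. The derived set $K^{(1)}=K'$ is the set of accumulation points of $K$, $K^{(n+1)}=(K^{(n)})'$, and the $\omega$-derived set is $K^{\omega}=\bigcap_{n} K^{(n)}$. A short exact sequence of Banach spaces is a diagram $0\to Y\xrightarrow{i} X\xrightarrow{q} Z\to 0$ of Banach spaces and bounded linear operators in which the kernel of each arrow equals the image of the preceding one. It is trivial (splits) if $i(Y)$ is complemented in $X$, i.e. is the range of a bounded linear projection on $X$. One writes $\operatorname{Ext}(Z,Y)=0$ if every short exact sequence $0\to Y\to X\to Z\to 0$ of Banach spaces splits, and $\operatorname{Ext}(Z,Y)\neq 0$ otherwise, i.e. if some such sequence does not split.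
   Formalization: The formal statement additionally assumes that S is infinite; for finite S the space C(S) is finite-dimensional, hence always complemented, so Ext(C(K),C(S)) = 0 and the claim as written fails. *)

theory Defs
  imports "HOL-Analysis.Analysis" "HOL-Algebra.Module" "HOL-Algebra.AbelCoset"
begin

text \<open>
  An extension of one Banach space by another is a Banach space that is not known in
  advance, so it has to be quantified over inside a formula. A type-class Banach space
  cannot be quantified over; hence Banach spaces are normed modules in the sense of
  HOL-Algebra. The fields \<open>mult\<close> and \<open>one\<close>, which the module record inherits from the
  ring record, carry no information.
\<close>

record ('k, 'x) normed_module = "('k, 'x) module" +
  vnorm :: "'x \<Rightarrow> real"

definition scalars :: "'k::real_normed_field ring"
  where "scalars = \<lparr> carrier = UNIV, mult = (*), one = 1, zero = 0, add = (+) \<rparr>"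

locale banach_space =
  module "scalars :: 'k ring" X
  for X :: "('k::real_normed_field, 'x) normed_module" (structure) +
  assumes vnorm_nonneg: "x \<in> carrier X \<Longrightarrow> 0 \<le> vnorm X x"
    and vnorm_eq_0_iff: "x \<in> carrier X \<Longrightarrow> vnorm X x = 0 \<longleftrightarrow> x = \<zero>"
    and vnorm_triangle:
      "x \<in> carrier X \<Longrightarrow> y \<in> carrier X \<Longrightarrow> vnorm X (x \<oplus> y) \<le> vnorm X x + vnorm X y"
    and vnorm_smult: "x \<in> carrier X \<Longrightarrow> vnorm X (c \<odot> x) = norm c * vnorm X x"
    and complete:
      "range s \<subseteq> carrier X \<Longrightarrow>
       (\<And>e. e > 0 \<Longrightarrow> \<exists>N. \<forall>m\<ge>N. \<forall>n\<ge>N. vnorm X (s m \<ominus> s n) < e) \<Longrightarrow>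
       \<exists>l\<in>carrier X. (\<lambda>n. vnorm X (s n \<ominus> l)) \<longlonglongrightarrow> 0"

definition bounded_operator ::
    "('k::real_normed_field, 'x) normed_module \<Rightarrow> ('k, 'y) normed_module \<Rightarrow> ('x \<Rightarrow> 'y) \<Rightarrow> bool"
  where "bounded_operator X Y T \<longleftrightarrow>
    T \<in> carrier X \<rightarrow> carrier Y \<and>
    (\<forall>x\<in>carrier X. \<forall>y\<in>carrier X. T (x \<oplus>\<^bsub>X\<^esub> y) = T x \<oplus>\<^bsub>Y\<^esub> T y) \<and>
    (\<forall>c. \<forall>x\<in>carrier X. T (c \<odot>\<^bsub>X\<^esub> x) = c \<odot>\<^bsub>Y\<^esub> T x) \<and>
    (\<exists>B. \<forall>x\<in>carrier X. vnorm Y (T x) \<le> B * vnorm X x)"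

definition complemented ::
    "('k::real_normed_field, 'x) normed_module \<Rightarrow> 'x set \<Rightarrow> bool"
  where "complemented X M \<longleftrightarrow>
    (\<exists>P. bounded_operator X X P \<and> (\<forall>x\<in>carrier X. P (P x) = P x) \<and> P ` carrier X = M)"

definition short_exact ::
    "('k::real_normed_field, 'y) normed_module \<Rightarrow> ('k, 'x) normed_module \<Rightarrow>
     ('k, 'z) normed_module \<Rightarrow> ('y \<Rightarrow> 'x) \<Rightarrow> ('x \<Rightarrow> 'z) \<Rightarrow> bool"
  where "short_exact Y X Z i q \<longleftrightarrow>
    banach_space Y \<and> banach_space X \<and> banach_space Z \<and>
    bounded_operator Y X i \<and> bounded_operator X Z q \<and>
    a_kernel Y X i = {\<zero>\<^bsub>Y\<^esub>} \<and>
    a_kernel X Z q = i ` carrier Y \<and>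
    carrier Z = q ` carrier X"

text \<open>
  The middle space ranges over all Banach spaces whose underlying set is a subset of the
  type \<open>'y \<times> 'z\<close>. This loses no generality: as a set, an extension of \<open>Z\<close> by \<open>Y\<close> is in
  bijection with the product of the two carriers. Lemma \<open>Ext_zero_imp_splits\<close> below
  confirms that sequences with a middle space over an arbitrary type are covered.
\<close>

definition Ext_zero ::
    "('k::real_normed_field, 'z) normed_module \<Rightarrow> ('k, 'y) normed_module \<Rightarrow> bool"
  where "Ext_zero Z Y \<longleftrightarrow>
    (\<forall>(X :: ('k, 'y \<times> 'z) normed_module) i q.
       short_exact Y X Z i q \<longrightarrow> complemented X (i ` carrier Y))"

text \<open>
  Functions are made extensional outside \<open>topspace K\<close>, so that equality in the carrier is
  equality on \<open>K\<close>.
\<close>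

definition C_space :: "'a topology \<Rightarrow> ('k::real_normed_field, 'a \<Rightarrow> 'k) normed_module"
  where "C_space K =
    \<lparr> carrier = {f \<in> extensional (topspace K). continuous_map K euclidean f},
      mult = (\<lambda>f g. \<lambda>x\<in>topspace K. f x * g x),
      one = (\<lambda>x\<in>topspace K. 1),
      zero = (\<lambda>x\<in>topspace K. 0),
      add = (\<lambda>f g. \<lambda>x\<in>topspace K. f x + g x),
      smult = (\<lambda>c f. \<lambda>x\<in>topspace K. c * f x),
      vnorm = (\<lambda>f. SUP x\<in>topspace K. norm (f x)) \<rparr>"

text \<open>
  In a Hausdorff space each iterate is closed, so taking accumulation points in \<open>K\<close> agrees
  with taking accumulation points in the iterate regarded as a space of its own.
\<close>

definition omega_derived_set :: "'a topology \<Rightarrow> 'a set"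
  where "omega_derived_set K = (\<Inter>n. ((derived_set_of) K ^^ n) (topspace K))"

definition continuum_hypothesis :: bool
  where "continuum_hypothesis \<longleftrightarrow> (card_of (UNIV :: real set), cardSuc natLeq) \<in> ordIso"

lemma scalars_simps [simp]:
  "carrier scalars = UNIV" "a \<otimes>\<^bsub>scalars\<^esub> b = a * b" "a \<oplus>\<^bsub>scalars\<^esub> b = a + b"
  "\<one>\<^bsub>scalars\<^esub> = 1" "\<zero>\<^bsub>scalars\<^esub> = 0"
  by (simp_all add: scalars_def)

lemma cring_scalars: "cring scalars"
  by (intro cringI abelian_groupI comm_monoidI)
     (auto simp: algebra_simps intro: exI[of _ "- _"])

lemma C_space_simps [simp]:
  "f \<in> carrier (C_space K) \<longleftrightarrow> f \<in> extensional (topspace K) \<and> continuous_map K euclidean f"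
  "\<zero>\<^bsub>C_space K\<^esub> = (\<lambda>x\<in>topspace K. 0)"
  "f \<oplus>\<^bsub>C_space K\<^esub> g = (\<lambda>x\<in>topspace K. f x + g x)"
  "c \<odot>\<^bsub>C_space K\<^esub> f = (\<lambda>x\<in>topspace K. c * f x)"
  "vnorm (C_space K) f = (SUP x\<in>topspace K. norm (f x))"
  by (simp_all add: C_space_def)

lemma continuous_map_restrict_topspace [simp]:
  "continuous_map K L (restrict f (topspace K)) \<longleftrightarrow> continuous_map K L f"
  by (metis continuous_map_eq restrict_apply')

lemma continuous_map_cmult:
  fixes f :: "'a \<Rightarrow> 'k::real_normed_field"
  shows "continuous_map K euclidean f \<Longrightarrow> continuous_map K euclidean (\<lambda>x. c * f x)"
  by (simp add: continuous_map_atin tendsto_mult)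

lemma abelian_group_C_space: "abelian_group (C_space K)"
proof (rule abelian_groupI)
  fix f assume f: "f \<in> carrier (C_space K)"
  then show "\<exists>g\<in>carrier (C_space K). g \<oplus>\<^bsub>C_space K\<^esub> f = \<zero>\<^bsub>C_space K\<^esub>"
    by (intro bexI[of _ "\<lambda>x\<in>topspace K. - f x"]) (auto intro!: restrict_ext)
  show "\<zero>\<^bsub>C_space K\<^esub> \<oplus>\<^bsub>C_space K\<^esub> f = f"
    using f by (auto simp: extensional_def fun_eq_iff)
qed (auto intro!: restrict_ext continuous_map_add simp: algebra_simps)

lemma module_C_space: "module scalars (C_space K)"
  by (intro moduleI cring_scalars abelian_group_C_space)
     (auto intro!: restrict_ext continuous_map_cmult simp: algebra_simps extensional_def fun_eq_iff)

lemma minus_C_space: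
  assumes "f \<in> carrier (C_space K)" "g \<in> carrier (C_space K)"
  shows "f \<ominus>\<^bsub>C_space K\<^esub> g = (\<lambda>x\<in>topspace K. f x - g x)"
proof -
  interpret abelian_group "C_space K" by (rule abelian_group_C_space)
  have "\<ominus>\<^bsub>C_space K\<^esub> g = (\<lambda>x\<in>topspace K. - g x)"
    using assms by (intro minus_equality) (auto intro!: restrict_ext)
  then show ?thesis by (auto simp: a_minus_def intro!: restrict_ext)
qed

lemma banach_space_C_space:
  fixes K :: "'a topology"
  assumes K: "compact_space K" and ne: "topspace K \<noteq> {}"
  shows "banach_space (C_space K :: ('k::{real_normed_field, banach}, _) normed_module)"
proof -
  let ?C = "C_space K :: ('k, _) normed_module"
  let ?T = "topspace K"
  interpret module scalars ?C by (rule module_C_space)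
  have bdd: "bdd_above ((\<lambda>x. norm (f x)) ` ?T)" if "f \<in> carrier ?C" for f
  proof -
    have "compactin euclidean (f ` ?T)"
      using that K image_compactin[of K ?T euclidean f] by (auto simp: compact_space_def)
    then have "bounded (f ` ?T)" by (simp add: compact_imp_bounded)
    then show ?thesis by (force simp: bounded_iff bdd_above_def)
  qed
  have up: "norm (f x) \<le> vnorm ?C f" if "f \<in> carrier ?C" "x \<in> ?T" for f x
    using cSUP_upper[OF that(2) bdd[OF that(1)]] by simp
  have lo: "vnorm ?C f \<le> b" if "\<And>x. x \<in> ?T \<Longrightarrow> norm (f x) \<le> b" for f :: "'a \<Rightarrow> 'k" and b
    using that ne by (simp add: cSUP_least)
  have nonneg: "0 \<le> vnorm ?C f" if f: "f \<in> carrier ?C" for f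
    using ne up[OF f] by (meson ex_in_conv norm_ge_zero order_trans)
  show ?thesis
  proof
    fix f g assume f: "f \<in> carrier ?C"
    show "0 \<le> vnorm ?C f" by (rule nonneg[OF f])
    show "vnorm ?C f = 0 \<longleftrightarrow> f = \<zero>\<^bsub>?C\<^esub>"
    proof
      assume "vnorm ?C f = 0"
      then have "f x = 0" if "x \<in> ?T" for x using up[OF f that] by simp
      then show "f = \<zero>\<^bsub>?C\<^esub>" using f by (auto simp: extensional_def fun_eq_iff)
    next
      assume f0: "f = \<zero>\<^bsub>?C\<^esub>"
      have "vnorm ?C f \<le> 0" by (rule lo) (simp add: f0)
      with nonneg[OF f] show "vnorm ?C f = 0" by linarith
    qed
    show "vnorm ?C (f \<oplus>\<^bsub>?C\<^esub> g) \<le> vnorm ?C f + vnorm ?C g" if g: "g \<in> carrier ?C"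
    proof (rule lo)
      fix x assume x: "x \<in> ?T"
      have "norm (f x + g x) \<le> norm (f x) + norm (g x)" by (rule norm_triangle_ineq)
      then show "norm ((f \<oplus>\<^bsub>?C\<^esub> g) x) \<le> vnorm ?C f + vnorm ?C g"
        using x up[OF f x] up[OF g x] by (simp del: C_space_simps(5))
    qed
    show "vnorm ?C (c \<odot>\<^bsub>?C\<^esub> f) = norm c * vnorm ?C f" for c
    proof -
      have cf: "c \<odot>\<^bsub>?C\<^esub> f \<in> carrier ?C" using f by (intro smult_closed) auto
      have 1: "vnorm ?C (c \<odot>\<^bsub>?C\<^esub> f) \<le> norm c * vnorm ?C f"
        by (rule lo) (use up[OF f] in \<open>simp del: C_space_simps(5) add: norm_mult mult_left_mono\<close>)
      have 2: "norm c * vnorm ?C f \<le> vnorm ?C (c \<odot>\<^bsub>?C\<^esub> f)"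
      proof (cases "c = 0")
        case True then show ?thesis using nonneg[OF cf] by (simp del: C_space_simps(5))
      next
        case False
        have "vnorm ?C f \<le> vnorm ?C (c \<odot>\<^bsub>?C\<^esub> f) / norm c"
          using up[OF cf] False
          by (intro lo) (simp del: C_space_simps(5) add: norm_mult field_simps)
        then show ?thesis using False by (simp del: C_space_simps(5) add: field_simps)
      qed
      from 1 2 show ?thesis by linarith
    qed
  next
    fix s :: "nat \<Rightarrow> 'a \<Rightarrow> 'k"
    assume s: "range s \<subseteq> carrier ?C"
      and Cau: "\<And>e. e > 0 \<Longrightarrow> \<exists>N. \<forall>m\<ge>N. \<forall>n\<ge>N. vnorm ?C (s m \<ominus>\<^bsub>?C\<^esub> s n) < e"
    have sC: "s n \<in> carrier ?C" for n using s by (simp only: range_subsetD)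
    have pt: "norm (f x - g x) \<le> vnorm ?C (f \<ominus>\<^bsub>?C\<^esub> g)"
      if "f \<in> carrier ?C" "g \<in> carrier ?C" "x \<in> ?T" for f g x
      using up[OF minus_closed[OF that(1,2)] that(3)] that
      by (simp only: minus_C_space[OF that(1,2)] restrict_apply' that)
    have "Cauchy (\<lambda>n. s n x)" if "x \<in> ?T" for x
      unfolding Cauchy_def dist_norm
    proof (intro allI impI)
      fix e :: real assume "e > 0"
      then obtain N where "\<forall>m\<ge>N. \<forall>n\<ge>N. vnorm ?C (s m \<ominus>\<^bsub>?C\<^esub> s n) < e"
        using Cau by blast
      then show "\<exists>N. \<forall>m\<ge>N. \<forall>n\<ge>N. norm (s m x - s n x) < e"
        using order_le_less_trans[OF pt[OF sC sC that]] by blast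
    qed
    then have lim: "(\<lambda>n. s n x) \<longlonglongrightarrow> lim (\<lambda>n. s n x)" if "x \<in> ?T" for x
      using that by (simp add: Cauchy_convergent convergent_LIMSEQ_iff[symmetric])
    define l where "l = (\<lambda>x\<in>?T. lim (\<lambda>n. s n x))"
    have unif: "\<exists>N. \<forall>n\<ge>N. \<forall>x\<in>?T. norm (s n x - l x) \<le> e" if e: "e > 0" for e
    proof -
      obtain N where N: "\<And>m n. m \<ge> N \<Longrightarrow> n \<ge> N \<Longrightarrow> vnorm ?C (s m \<ominus>\<^bsub>?C\<^esub> s n) < e"
        using Cau[OF e] by blast
      have "norm (s n x - l x) \<le> e" if n: "n \<ge> N" and x: "x \<in> ?T" for n x
      proof (rule tendsto_upperbound)
        show "(\<lambda>m. norm (s n x - s m x)) \<longlonglongrightarrow> norm (s n x - l x)"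
          using lim[OF x] x by (auto simp: l_def intro!: tendsto_intros)
        show "\<forall>\<^sub>F m in sequentially. norm (s n x - s m x) \<le> e"
          unfolding eventually_sequentially
          using less_imp_le[OF order_le_less_trans[OF pt[OF sC sC x] N[OF n]]] by blast
      qed simp
      then show ?thesis by blast
    qed
    have "continuous_map K Met_TC.mtopology l"
    proof (rule Met_TC.continuous_map_uniform_limit)
      show "\<forall>\<^sub>F n in sequentially. continuous_map K Met_TC.mtopology (s n)"
        using sC by simp
      show "\<forall>\<^sub>F n in sequentially. \<forall>x\<in>?T. l x \<in> UNIV \<and> dist (s n x) (l x) < e" if e: "e > 0" for e
      proof -
        obtain N where "\<forall>n\<ge>N. \<forall>x\<in>?T. norm (s n x - l x) \<le> e / 2"
          using unif[of "e / 2"] e by auto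
        then show ?thesis
          using e unfolding eventually_sequentially dist_norm
          by (intro exI[of _ N]) fastforce
      qed
    qed simp
    then have l: "l \<in> carrier ?C" by (simp add: l_def)
    have "(\<lambda>n. vnorm ?C (s n \<ominus>\<^bsub>?C\<^esub> l)) \<longlonglongrightarrow> 0"
    proof (rule LIMSEQ_I)
      fix e :: real assume e: "e > 0"
      obtain N where N: "\<forall>n\<ge>N. \<forall>x\<in>?T. norm (s n x - l x) \<le> e / 2"
        using unif[of "e / 2"] e by auto
      have "norm (vnorm ?C (s n \<ominus>\<^bsub>?C\<^esub> l) - 0) < e" if "n \<ge> N" for n
      proof -
        have "vnorm ?C (s n \<ominus>\<^bsub>?C\<^esub> l) \<le> e / 2"
          by (rule lo) (simp only: minus_C_space[OF sC l] restrict_apply' N that)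
        with nonneg[OF minus_closed[OF sC l], of n] e show ?thesis
          by (simp del: C_space_simps(5))
      qed
      then show "\<exists>N. \<forall>n\<ge>N. norm (vnorm ?C (s n \<ominus>\<^bsub>?C\<^esub> l) - 0) < e" by blast
    qed
    with l show "\<exists>l\<in>carrier ?C. (\<lambda>n. vnorm ?C (s n \<ominus>\<^bsub>?C\<^esub> l)) \<longlonglongrightarrow> 0" by blast
  qed
qed

lemma Ext_zero_imp_splits:
  fixes X :: "('k::real_normed_field, 'x) normed_module"
    and Y :: "('k, 'y) normed_module" and Z :: "('k, 'z) normed_module"
  assumes Ext: "Ext_zero Z Y" and ex: "short_exact Y X Z i q"
  shows "complemented X (i ` carrier Y)"
proof -
  have bX: "banach_space X" and bY: "banach_space Y" and bZ: "banach_space Z"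
    and iop: "bounded_operator Y X i" and qop: "bounded_operator X Z q"
    and ki: "a_kernel Y X i = {\<zero>\<^bsub>Y\<^esub>}" and kq: "a_kernel X Z q = i ` carrier Y"
    and qs: "carrier Z = q ` carrier X"
    using ex by (auto simp: short_exact_def)
  interpret X: banach_space X by (rule bX)
  interpret Z: banach_space Z by (rule bZ)
  have q_add: "q (x \<oplus>\<^bsub>X\<^esub> y) = q x \<oplus>\<^bsub>Z\<^esub> q y" if "x \<in> carrier X" "y \<in> carrier X" for x y
    using qop that by (simp add: bounded_operator_def)
  have q_closed: "q x \<in> carrier Z" if "x \<in> carrier X" for x
    using qs that by auto
  have "\<forall>z\<in>carrier Z. \<exists>x\<in>carrier X. q x = z" using qs by (metis imageE)
  then obtain r where r: "\<And>z. z \<in> carrier Z \<Longrightarrow> r z \<in> carrier X \<and> q (r z) = z" by metis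
  have q_minus: "q (x \<ominus>\<^bsub>X\<^esub> y) = \<zero>\<^bsub>Z\<^esub>"
    if "x \<in> carrier X" "y \<in> carrier X" "q x = q y" for x y
  proof -
    have "q y = q (x \<ominus>\<^bsub>X\<^esub> y) \<oplus>\<^bsub>Z\<^esub> q y"
      using that q_add[of "x \<ominus>\<^bsub>X\<^esub> y" y] by (simp add: a_minus_def X.a_assoc X.l_neg)
    then show ?thesis
      using that q_closed by (metis X.minus_closed Z.add.r_cancel_one')
  qed
  have "\<forall>x\<in>carrier X. \<exists>y\<in>carrier Y. i y = x \<ominus>\<^bsub>X\<^esub> r (q x)"
  proof
    fix x assume x: "x \<in> carrier X"
    then have "x \<ominus>\<^bsub>X\<^esub> r (q x) \<in> a_kernel X Z q"
      using r[OF q_closed[OF x]] q_minus[of x "r (q x)"] by (simp add: a_kernel_def')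
    then show "\<exists>y\<in>carrier Y. i y = x \<ominus>\<^bsub>X\<^esub> r (q x)" using kq by auto
  qed
  then obtain t where t: "\<And>x. x \<in> carrier X \<Longrightarrow> i (t x) = x \<ominus>\<^bsub>X\<^esub> r (q x)" by metis
  define \<phi> where "\<phi> x = (t x, q x)" for x
  have inj: "inj_on \<phi> (carrier X)"
  proof (rule inj_onI)
    fix x y assume x: "x \<in> carrier X" and y: "y \<in> carrier X" and "\<phi> x = \<phi> y"
    then have "x \<ominus>\<^bsub>X\<^esub> r (q x) = y \<ominus>\<^bsub>X\<^esub> r (q x)" using t by (metis \<phi>_def prod.inject)
    moreover have "r (q x) \<in> carrier X" using r[OF q_closed[OF x]] by simp
    ultimately show "x = y" using x y by (simp add: a_minus_def)
  qed
  define \<psi> where "\<psi> = inv_into (carrier X) \<phi>"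
  have \<psi>: "\<psi> (\<phi> x) = x" if "x \<in> carrier X" for x
    using inj that by (simp add: \<psi>_def)
  define X' :: "('k, 'y \<times> 'z) normed_module" where "X' =
    \<lparr> carrier = \<phi> ` carrier X, mult = undefined, one = undefined, zero = \<phi> \<zero>\<^bsub>X\<^esub>,
      add = (\<lambda>a b. \<phi> (\<psi> a \<oplus>\<^bsub>X\<^esub> \<psi> b)), smult = (\<lambda>c a. \<phi> (c \<odot>\<^bsub>X\<^esub> \<psi> a)),
      vnorm = (\<lambda>a. vnorm X (\<psi> a)) \<rparr>"
  have X': "carrier X' = \<phi> ` carrier X" "\<zero>\<^bsub>X'\<^esub> = \<phi> \<zero>\<^bsub>X\<^esub>"
    "a \<oplus>\<^bsub>X'\<^esub> b = \<phi> (\<psi> a \<oplus>\<^bsub>X\<^esub> \<psi> b)" "c \<odot>\<^bsub>X'\<^esub> a = \<phi> (c \<odot>\<^bsub>X\<^esub> \<psi> a)"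
    "vnorm X' a = vnorm X (\<psi> a)" for a b c
    by (simp_all add: X'_def)
  have smult_closed: "c \<odot>\<^bsub>X\<^esub> x \<in> carrier X" if "x \<in> carrier X" for c x
    using that by (intro X.smult_closed) auto
  have ab: "abelian_group X'"
  proof (rule abelian_groupI)
    fix a assume "a \<in> carrier X'"
    then obtain x where x: "x \<in> carrier X" "a = \<phi> x" by (auto simp: X')
    then show "\<exists>b\<in>carrier X'. b \<oplus>\<^bsub>X'\<^esub> a = \<zero>\<^bsub>X'\<^esub>"
      by (intro bexI[of _ "\<phi> (\<ominus>\<^bsub>X\<^esub> x)"]) (auto simp: X' \<psi> X.l_neg)
  qed (auto simp: X' \<psi> X.a_ac)
  interpret X': abelian_group X' by (rule ab)
  have mod: "module scalars X'"
  proof (intro moduleI cring_scalars ab)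
    show "(a \<oplus>\<^bsub>scalars\<^esub> b) \<odot>\<^bsub>X'\<^esub> v = a \<odot>\<^bsub>X'\<^esub> v \<oplus>\<^bsub>X'\<^esub> b \<odot>\<^bsub>X'\<^esub> v"
      if "v \<in> carrier X'" for a b v
      using that X.smult_l_distr[of a b] by (auto simp: X' \<psi> smult_closed)
    show "(a \<otimes>\<^bsub>scalars\<^esub> b) \<odot>\<^bsub>X'\<^esub> v = a \<odot>\<^bsub>X'\<^esub> (b \<odot>\<^bsub>X'\<^esub> v)"
      if "v \<in> carrier X'" for a b v
      using that X.smult_assoc1[of a b] by (auto simp: X' \<psi> smult_closed)
    show "\<one>\<^bsub>scalars\<^esub> \<odot>\<^bsub>X'\<^esub> v = v" if "v \<in> carrier X'" for v
      using that X.smult_one by (auto simp: X' \<psi>)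
  qed (auto simp: X' \<psi> smult_closed X.smult_r_distr)
  have minus: "\<phi> x \<ominus>\<^bsub>X'\<^esub> \<phi> y = \<phi> (x \<ominus>\<^bsub>X\<^esub> y)" if "x \<in> carrier X" "y \<in> carrier X" for x y
  proof -
    have "\<ominus>\<^bsub>X'\<^esub> \<phi> y = \<phi> (\<ominus>\<^bsub>X\<^esub> y)"
      using that by (intro X'.minus_equality) (auto simp: X' \<psi> X.l_neg)
    then show ?thesis using that by (simp add: a_minus_def X' \<psi>)
  qed
  have bX': "banach_space X'"
  proof (intro banach_space.intro mod banach_space_axioms.intro)
    fix a assume "a \<in> carrier X'"
    then obtain x where x: "x \<in> carrier X" "a = \<phi> x" by (auto simp: X')
    show "0 \<le> vnorm X' a" using x X.vnorm_nonneg by (simp add: X' \<psi>)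
    show "vnorm X' a = 0 \<longleftrightarrow> a = \<zero>\<^bsub>X'\<^esub>"
      using x X.vnorm_eq_0_iff by (simp add: X' \<psi> inj_on_eq_iff[OF inj])
    show "vnorm X' (c \<odot>\<^bsub>X'\<^esub> a) = norm c * vnorm X' a" for c
      using x X.vnorm_smult by (simp add: X' \<psi> smult_closed)
    show "vnorm X' (a \<oplus>\<^bsub>X'\<^esub> b) \<le> vnorm X' a + vnorm X' b" if "b \<in> carrier X'" for b
      using x that X.vnorm_triangle by (auto simp: X' \<psi>)
  next
    fix s :: "nat \<Rightarrow> 'y \<times> 'z"
    assume s: "range s \<subseteq> carrier X'"
      and Cau: "\<And>e. e > 0 \<Longrightarrow> \<exists>N. \<forall>m\<ge>N. \<forall>n\<ge>N. vnorm X' (s m \<ominus>\<^bsub>X'\<^esub> s n) < e"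
    have "\<forall>n. \<exists>x\<in>carrier X. s n = \<phi> x" using s by (auto simp: X')
    then obtain u where u: "\<And>n. u n \<in> carrier X" "\<And>n. s n = \<phi> (u n)" by metis
    have "vnorm X' (s m \<ominus>\<^bsub>X'\<^esub> s n) = vnorm X (u m \<ominus>\<^bsub>X\<^esub> u n)" for m n
      using u by (simp add: minus X' \<psi>)
    with Cau have "\<exists>l\<in>carrier X. (\<lambda>n. vnorm X (u n \<ominus>\<^bsub>X\<^esub> l)) \<longlonglongrightarrow> 0"
      by (intro X.complete) (use u in auto)
    then obtain l where l: "l \<in> carrier X" "(\<lambda>n. vnorm X (u n \<ominus>\<^bsub>X\<^esub> l)) \<longlonglongrightarrow> 0" by blast
    then show "\<exists>l\<in>carrier X'. (\<lambda>n. vnorm X' (s n \<ominus>\<^bsub>X'\<^esub> l)) \<longlonglongrightarrow> 0"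
      using u by (intro bexI[of _ "\<phi> l"]) (simp_all add: minus X' \<psi>)
  qed
  have iX: "i y \<in> carrier X" if "y \<in> carrier Y" for y
    using iop that by (auto simp: bounded_operator_def)
  have "short_exact Y X' Z (\<phi> \<circ> i) (q \<circ> \<psi>)"
    unfolding short_exact_def
  proof (intro conjI bX' bY bZ)
    show "bounded_operator Y X' (\<phi> \<circ> i)"
      using iop by (auto simp: bounded_operator_def X' \<psi> iX)
    show "bounded_operator X' Z (q \<circ> \<psi>)"
      using qop by (auto simp: bounded_operator_def X' \<psi> smult_closed)
    have "\<phi> (i y) = \<phi> \<zero>\<^bsub>X\<^esub> \<longleftrightarrow> i y = \<zero>\<^bsub>X\<^esub>" if "y \<in> carrier Y" for y
      using inj_on_eq_iff[OF inj iX[OF that] X.zero_closed] .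
    then have "a_kernel Y X' (\<phi> \<circ> i) = a_kernel Y X i"
      by (auto simp: a_kernel_def' X')
    then show "a_kernel Y X' (\<phi> \<circ> i) = {\<zero>\<^bsub>Y\<^esub>}" using ki by simp
    have "a_kernel X' Z (q \<circ> \<psi>) = \<phi> ` a_kernel X Z q"
      by (auto simp: a_kernel_def' X' \<psi>)
    then show "a_kernel X' Z (q \<circ> \<psi>) = (\<phi> \<circ> i) ` carrier Y"
      by (simp add: kq image_comp)
    show "carrier Z = (q \<circ> \<psi>) ` carrier X'"
      by (auto simp: X' qs \<psi> image_comp)
  qed
  then have "complemented X' ((\<phi> \<circ> i) ` carrier Y)"
    using Ext unfolding Ext_zero_def by blast
  then obtain P where P: "bounded_operator X' X' P" "\<forall>a\<in>carrier X'. P (P a) = P a"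
    "P ` carrier X' = (\<phi> \<circ> i) ` carrier Y"
    by (auto simp: complemented_def)
  have PX: "\<exists>y\<in>carrier X. P (\<phi> x) = \<phi> y" if "x \<in> carrier X" for x
    using P(1) that by (auto simp: bounded_operator_def X')
  show ?thesis
    unfolding complemented_def
  proof (intro exI[of _ "\<psi> \<circ> P \<circ> \<phi>"] conjI ballI)
    show "bounded_operator X X (\<psi> \<circ> P \<circ> \<phi>)"
      unfolding bounded_operator_def
    proof (intro conjI ballI allI)
      show "\<psi> \<circ> P \<circ> \<phi> \<in> carrier X \<rightarrow> carrier X" using PX by (force simp: \<psi>)
      show "(\<psi> \<circ> P \<circ> \<phi>) (x \<oplus>\<^bsub>X\<^esub> y) = (\<psi> \<circ> P \<circ> \<phi>) x \<oplus>\<^bsub>X\<^esub> (\<psi> \<circ> P \<circ> \<phi>) y"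
        if "x \<in> carrier X" "y \<in> carrier X" for x y
      proof -
        have "P (\<phi> x \<oplus>\<^bsub>X'\<^esub> \<phi> y) = P (\<phi> x) \<oplus>\<^bsub>X'\<^esub> P (\<phi> y)"
          using P(1) that by (simp add: bounded_operator_def X')
        then show ?thesis using PX[OF that(1)] PX[OF that(2)] that by (auto simp: X' \<psi>)
      qed
      show "(\<psi> \<circ> P \<circ> \<phi>) (c \<odot>\<^bsub>X\<^esub> x) = c \<odot>\<^bsub>X\<^esub> (\<psi> \<circ> P \<circ> \<phi>) x" if "x \<in> carrier X" for c x
      proof -
        have "P (c \<odot>\<^bsub>X'\<^esub> \<phi> x) = c \<odot>\<^bsub>X'\<^esub> P (\<phi> x)"
          using P(1) that by (simp add: bounded_operator_def X')
        then show ?thesis using PX[OF that] that by (auto simp: X' \<psi> smult_closed)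
      qed
      show "\<exists>B. \<forall>x\<in>carrier X. vnorm X ((\<psi> \<circ> P \<circ> \<phi>) x) \<le> B * vnorm X x"
        using P(1) by (auto simp: bounded_operator_def X' \<psi>)
    qed
    show "(\<psi> \<circ> P \<circ> \<phi>) ((\<psi> \<circ> P \<circ> \<phi>) x) = (\<psi> \<circ> P \<circ> \<phi>) x" if "x \<in> carrier X" for x
    proof -
      have "P (P (\<phi> x)) = P (\<phi> x)" using P(2) that by (simp add: X')
      then show ?thesis using PX[OF that] by (auto simp: \<psi>)
    qed
    have "(\<psi> \<circ> P \<circ> \<phi>) ` carrier X = \<psi> ` (P ` carrier X')"
      by (simp add: X' image_comp comp_assoc)
    also have "\<dots> = i ` carrier Y"
      unfolding P(3) by (simp add: image_image \<psi> iX cong: image_cong)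
    finally show "(\<psi> \<circ> P \<circ> \<phi>) ` carrier X = i ` carrier Y" .
  qed
qed

end

theory Submission
  imports Defs "HOL-Library.Countable_Set_Type"
begin

text \<open>
  The nontrivial extension is found by counting: there are \<open>2\<close> to the power continuum many
  candidates, but a splitting of a candidate determines it through an amount of data of which
  there are only continuum many instances.

  \<^emph>\<open>The candidates.\<close> Let \<open>K\<close> be a nonmetrizable compact space with empty \<open>\<omega>\<close>-derived set.
  Some finite derived set of \<open>K\<close> is empty, and \<open>K\<close> is uncountable. A closed uncountable
  subset of least height yields an uncountable set \<open>\<Gamma>\<close> with a single accumulation point \<open>x0\<close>
  (\<open>uncountable_convergent_subset\<close>). By the Continuum Hypothesis there is an injection \<open>g\<close> from
  the set of all \<open>s :: nat \<Rightarrow> bool\<close> into \<open>\<Gamma>\<close>, and since \<open>K\<close> is zero-dimensional each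
  \<open>g s\<close> lies in a clopen set \<open>U s\<close> that contains neither \<open>x0\<close> nor the other points of \<open>\<Gamma>\<close>.
  On the other side, \<open>S\<close> contains isolated points \<open>y n\<close> that converge to a point \<open>p\<close>; they span
  a complemented copy of \<open>c_0\<close> in \<open>C(S)\<close>. Let \<open>A s\<close> be an almost disjoint family of infinite
  sets of natural numbers. For each set \<open>E\<close> of indices, detach the \<open>y n\<close> from \<open>p\<close> and glue
  them to \<open>K\<close> instead: along \<open>A s\<close> with \<open>s \<in> E\<close> they now converge to \<open>g s\<close>, and the
  others converge to \<open>x0\<close>. The result is a compact space \<open>M\<close>, and restriction to \<open>K\<close> gives an
  exact sequence \<open>0 \<rightarrow> C(S) \<rightarrow> C(M) \<rightarrow> C(K) \<rightarrow> 0\<close> (\<open>short_exact_glued\<close>).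

  \<^emph>\<open>What a splitting yields.\<close> A projection of \<open>C(M)\<close> onto the image of \<open>C(S)\<close> produces
  bounded functionals \<open>\<phi> n\<close> on \<open>C(K)\<close>: extend \<open>f\<close> to \<open>M\<close>, subtract the projection, and
  evaluate at \<open>y n\<close>. Applied to the indicator of \<open>U s\<close>, they converge to \<open>1\<close> along \<open>A s\<close> if
  \<open>s \<in> E\<close>, and to \<open>0\<close> otherwise (\<open>splitting_yields_functionals\<close>). So the numbers
  \<open>\<phi> n (U s)\<close>, known up to a small error, determine \<open>E\<close>.

  \<^emph>\<open>Counting.\<close> Because \<open>K\<close> has finite height, a bounded functional is small on every clopen set
  that misses a suitable finite set \<open>F\<close> (\<open>additive_small_off_finite_set\<close>). Hence up to a small
  error its value at \<open>U s\<close> depends only on the trace of \<open>U s\<close> on \<open>F\<close>. Moreover, the points of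
  \<open>K\<close> show only continuum many membership patterns with respect to the sets \<open>U s\<close>
  (\<open>clopen_membership_patterns_coded_by_lists\<close>), so \<open>F\<close> may be replaced by a finite list of
  codes. If all the sequences split, every \<open>E\<close> would therefore be decoded from a sequence of
  finite amounts of data, which contradicts Cantor's theorem
  (\<open>clopen_functionals_cannot_select_all_subsets\<close>).
\<close>

section \<open>Spaces of finite height\<close>

abbreviation iter_derived :: "'a topology \<Rightarrow> nat \<Rightarrow> 'a set \<Rightarrow> 'a set"
  where "iter_derived K n L \<equiv> ((derived_set_of) K ^^ n) L"

lemma iter_derived_mono: "A \<subseteq> B \<Longrightarrow> iter_derived K n A \<subseteq> iter_derived K n B"
  by (induction n) (auto intro: derived_set_of_mono[THEN subsetD])

lemma iter_derived_closedin:
  assumes "Hausdorff_space K" "closedin K L"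
  shows "closedin K (iter_derived K n L)"
  by (cases n) (simp_all add: assms closedin_derived_set_of)

lemma derived_set_of_closedin_subset: "closedin K L \<Longrightarrow> K derived_set_of L \<subseteq> L"
  by (simp add: closedin_contains_derived_set)

lemma iter_derived_Suc_subset:
  assumes "Hausdorff_space K" "closedin K L"
  shows "iter_derived K (Suc n) L \<subseteq> iter_derived K n L"
  using derived_set_of_closedin_subset[OF iter_derived_closedin[OF assms]] by simp

lemma iter_derived_antimono:
  assumes "Hausdorff_space K" "closedin K L" "m \<le> n"
  shows "iter_derived K n L \<subseteq> iter_derived K m L"
  by (rule lift_Suc_antimono_le[of "\<lambda>n. iter_derived K n L", OF iter_derived_Suc_subset[OF assms(1,2)] assms(3)])

lemma Hausdorff_separate_point_compact:
  assumes "Hausdorff_space K" "compactin K T" "y \<in> topspace K" "y \<notin> T"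
  shows "\<exists>V W. openin K V \<and> openin K W \<and> y \<in> V \<and> T \<subseteq> W \<and> disjnt V W"
  using Hausdorff_space_compact_separation[of K "{y}" T] assms
  by (metis compactin_sing disjnt_empty1 disjnt_insert1 insert_subset)

lemma finite_height:
  assumes "compact_space K" "Hausdorff_space K" "omega_derived_set K = {}"
  obtains N where "iter_derived K N (topspace K) = {}"
proof -
  let ?U = "\<lambda>n. topspace K - iter_derived K n (topspace K)"
  have "topspace K \<subseteq> \<Union>(range ?U)"
    using assms(3) by (auto simp: omega_derived_set_def)
  moreover have "openin K W" if "W \<in> range ?U" for W
    using that iter_derived_closedin[OF assms(2) closedin_topspace] by (auto simp: closedin_def)
  ultimately obtain \<F> where F: "finite \<F>" "\<F> \<subseteq> range ?U" "topspace K \<subseteq> \<Union>\<F>"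
    using assms(1) unfolding compact_space_alt by metis
  then obtain I where I: "finite I" "\<F> = ?U ` I" by (meson finite_subset_image)
  then obtain N where N: "\<And>n. n \<in> I \<Longrightarrow> n \<le> N" by (meson finite_nat_set_iff_bounded_le)
  have "iter_derived K N (topspace K) = {}"
  proof (rule equals0I)
    fix y assume y: "y \<in> iter_derived K N (topspace K)"
    then have "y \<in> topspace K"
      using iter_derived_antimono[OF assms(2) closedin_topspace, of 0 N] by auto
    with F(3) I(2) obtain n where "n \<in> I" "y \<notin> iter_derived K n (topspace K)" by auto
    with y N iter_derived_antimono[OF assms(2) closedin_topspace, of n N] show False by blast
  qed
  with that show thesis by blast
qed

lemma perfect_subset_iter_derived:
  "P \<subseteq> K derived_set_of P \<Longrightarrow> P \<subseteq> topspace K \<Longrightarrow> P \<subseteq> iter_derived K n (topspace K)"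
  by (induction n) (auto dest: derived_set_of_mono[THEN subsetD])

text \<open>
A nondegenerate connected set is perfect, and a perfect set survives in every derived set. So a
space of finite height is totally disconnected, and in a compact Hausdorff space the
quasi-components are then points as well.
\<close>

lemma finite_height_separation:
  assumes K: "compact_space K" "Hausdorff_space K" "iter_derived K N (topspace K) = {}"
    and C: "closedin K C" "y \<in> topspace K" "y \<notin> C"
  obtains U where "openin K U" "closedin K U" "y \<in> U" "U \<inter> C = {}"
proof -
  have "connected_component_of_set K y = {y}"
  proof (rule ccontr)
    assume "connected_component_of_set K y \<noteq> {y}"
    moreover have "y \<in> connected_component_of_set K y"
      using C(2) by (simp add: connected_component_of_refl)
    ultimately have "\<nexists>a. connected_component_of_set K y = {a}" by (metis singletonD)
    then have "connected_component_of_set K y \<subseteq> K derived_set_of connected_component_of_set K y"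
      by (intro connectedin_imp_perfect K connectedin_connected_component_of)
    then have "connected_component_of_set K y \<subseteq> {}"
      using perfect_subset_iter_derived[of _ K N] connected_component_of_subset_topspace K(3)
      by metis
    with \<open>y \<in> connected_component_of_set K y\<close> show False by blast
  qed
  moreover have "quasi_component_of K y = connected_component_of K y"
    using K by (intro quasi_eq_connected_component_of) simp
  ultimately have q: "{y} \<in> quasi_components_of K"
    using C(2) unfolding quasi_components_of_def by (metis imageI)
  have "separated_between K {y} C"
    using separated_between_quasi_component_compact[OF q] C K closedin_compact_space
    by (metis disjnt_insert1 disjnt_empty1)
  with that show thesis
    by (force simp: separated_between)
qed

text \<open>
Countably many Urysohn functions separate all pairs of points, and so embed the space into a
countable power of the real line.
\<close>

lemma countable_compact_Hausdorff_metrizable: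
  assumes K: "compact_space K" "Hausdorff_space K" "countable (topspace K)"
  shows "metrizable_space K"
proof -
  let ?T = "topspace K"
  let ?I = "{(x, y) \<in> ?T \<times> ?T. x \<noteq> y}"
  have "\<exists>f::_\<Rightarrow>real. continuous_map K euclidean f \<and> f x \<noteq> f y" if "x \<in> ?T" "y \<in> ?T" "x \<noteq> y" for x y
  proof -
    have "completely_regular_space K"
      using K by (simp add: compact_Hausdorff_or_regular_imp_normal_space normal_imp_completely_regular_space)
    moreover have "closedin K {y}" "x \<in> topspace K - {y}"
      using that closedin_Hausdorff_singleton[OF K(2)] by auto
    ultimately obtain f :: "'a \<Rightarrow> real"
      where f: "continuous_map K (top_of_set {0..1}) f" "f x = 0" "f \<in> {y} \<rightarrow> {1}"
      unfolding completely_regular_space_def by blast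
    then have "continuous_map K euclidean f" "f x \<noteq> f y"
      by (simp_all add: continuous_map_in_subtopology)
    then show ?thesis by blast
  qed
  then have "\<forall>i\<in>?I. \<exists>f::_\<Rightarrow>real. continuous_map K euclidean f \<and> f (fst i) \<noteq> f (snd i)"
    by simp
  then obtain f :: "'a \<times> 'a \<Rightarrow> 'a \<Rightarrow> real" where
    f: "\<forall>i\<in>?I. continuous_map K euclidean (f i) \<and> f i (fst i) \<noteq> f i (snd i)"
    using bchoice[of ?I "\<lambda>i f. continuous_map K euclidean f \<and> f (fst i) \<noteq> f (snd i)"] by blast
  let ?P = "product_topology (\<lambda>_. euclideanreal) ?I"
  define e where "e = (\<lambda>z. \<lambda>i\<in>?I. f i z)"
  have ce: "continuous_map K ?P e"
    unfolding continuous_map_componentwise e_def using f by auto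
  have ie: "inj_on e ?T"
  proof (rule inj_onI, rule ccontr)
    fix x y assume xy: "x \<in> ?T" "y \<in> ?T" "e x = e y" "x \<noteq> y"
    then have "e x (x, y) = e y (x, y)" by simp
    then have "f (x, y) x = f (x, y) y" using xy(1,2,4) by (simp add: e_def)
    moreover have "f (x, y) x \<noteq> f (x, y) y" using xy bspec[OF f, of "(x, y)"] by simp
    ultimately show False by simp
  qed
  have H: "Hausdorff_space ?P" by (simp add: Hausdorff_space_product_topology)
  have "embedding_map K ?P e"
    by (intro injective_closed_imp_embedding_map ce ie continuous_imp_closed_map K H)
  then have "K homeomorphic_space subtopology ?P (e ` ?T)"
    using embedding_map_imp_homeomorphic_space by blast
  moreover have "metrizable_space ?P"
    using K(3) by (auto simp: metrizable_space_product_topology metrizable_space_euclidean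
      intro!: countable_subset[OF _ countable_SIGMA[of ?T "\<lambda>_. ?T"]])
  ultimately show ?thesis
    by (meson homeomorphic_metrizable_space metrizable_space_subtopology)
qed

lemma closedin_no_accumulation_imp_finite:
  assumes "compact_space K" "closedin K T" "K derived_set_of T = {}"
  shows "finite T"
  using assms compact_space_imp_Bolzano_Weierstrass closedin_subset by blast

text \<open>
Points are removed from \<open>T\<close> one at a time: of the two parts into which an open set around one
point of \<open>T\<close>, whose closure misses the rest of \<open>T\<close>, cuts \<open>\<Gamma>\<close>, at least one is uncountable.
\<close>

lemma uncountable_with_single_accumulation_point:
  assumes K: "Hausdorff_space K"
    and "finite T" "T \<subseteq> topspace K" "uncountable \<Gamma>" "K derived_set_of \<Gamma> \<subseteq> T"
  shows "\<exists>x \<Delta>. \<Delta> \<subseteq> \<Gamma> \<and> uncountable \<Delta> \<and> K derived_set_of \<Delta> \<subseteq> {x}"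
  using assms(2-)
proof (induction T arbitrary: \<Gamma> rule: finite_induct)
  case empty
  then show ?case by blast
next
  case (insert t T)
  obtain V W where VW: "openin K V" "openin K W" "t \<in> V" "T \<subseteq> W" "disjnt V W"
    using Hausdorff_separate_point_compact[OF K, of T t] insert by (auto simp: finite_imp_compactin)
  have *: "K derived_set_of (\<Gamma> \<inter> V) \<subseteq> topspace K - W" "K derived_set_of (\<Gamma> - V) \<subseteq> topspace K - V"
    using VW(1,2,5) unfolding disjnt_iff by (blast dest: in_derived_set_of[THEN iffD1])+
  show ?case
  proof (cases "countable (\<Gamma> \<inter> V)")
    case True
    then have "uncountable (\<Gamma> - V)"
      using insert by (metis Int_Diff_Un countable_Un)
    moreover have "K derived_set_of (\<Gamma> - V) \<subseteq> T"
      using *(2) VW(3) insert.prems(3) derived_set_of_mono[of "\<Gamma> - V" \<Gamma> K] by blast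
    ultimately obtain x \<Delta> where "\<Delta> \<subseteq> \<Gamma> - V" "uncountable \<Delta>" "K derived_set_of \<Delta> \<subseteq> {x}"
      using insert.IH[of "\<Gamma> - V"] insert.prems(1) by auto
    then show ?thesis by blast
  next
    case False
    moreover have "K derived_set_of (\<Gamma> \<inter> V) \<subseteq> {t}"
      using *(1) VW(4) insert.prems(3) derived_set_of_mono[of "\<Gamma> \<inter> V" \<Gamma> K] by blast
    ultimately show ?thesis by blast
  qed
qed

text \<open>
This finds a copy of the one-point compactification of an uncountable discrete space. Take a
closed uncountable set \<open>L\<close> of least height, and let the finite set \<open>T\<close> be its last nonempty
derived set. Both the derived set of \<open>L\<close> and the closed subsets of \<open>L\<close> that miss \<open>T\<close> have
smaller height, so they are countable. Hence removing from \<open>L\<close> a neighbourhood of every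
accumulation point outside \<open>T\<close> costs only countably many points, and what is left accumulates
only at \<open>T\<close>.
\<close>

lemma uncountable_convergent_subset:
  assumes K: "compact_space K" "Hausdorff_space K" "iter_derived K N (topspace K) = {}"
    and unc: "uncountable (topspace K)"
  obtains x \<Gamma> where "uncountable \<Gamma>" "\<Gamma> \<subseteq> topspace K" "x \<in> topspace K" "x \<notin> \<Gamma>"
    "K derived_set_of \<Gamma> \<subseteq> {x}"
proof -
  define P where "P n \<longleftrightarrow> (\<exists>L. closedin K L \<and> uncountable L \<and> iter_derived K n L = {})" for n
  have "P N" using K(3) unc unfolding P_def by blast
  then have PL: "P (LEAST n. P n)" by (rule LeastI)
  have "\<not> P 0" by (auto simp: P_def)
  with PL obtain m where m: "(LEAST n. P n) = Suc m" by (metis not0_implies_Suc)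
  have small: "countable M" if "closedin K M" "iter_derived K m M = {}" for M
    using not_less_Least[of m P] m that by (auto simp: P_def)
  from PL m obtain L where L: "closedin K L" "uncountable L" "iter_derived K (Suc m) L = {}"
    unfolding P_def by auto
  define T where "T = iter_derived K m L"
  have T: "finite T" "T \<subseteq> L"
    using closedin_no_accumulation_imp_finite[OF K(1) iter_derived_closedin[OF K(2) L(1)]]
      L(3) iter_derived_antimono[OF K(2) L(1), of 0 m]
    by (auto simp: T_def)
  have L': "countable (K derived_set_of L)"
    using small[of "K derived_set_of L"] closedin_derived_set_of[OF K(2)] L(3)
    by (simp add: funpow_swap1)
  have small': "countable M" if "closedin K M" "M \<subseteq> L" "M \<inter> T = {}" for M
  proof (rule small[OF that(1)])
    have "iter_derived K m M \<subseteq> M" using iter_derived_antimono[OF K(2) that(1), of 0 m] by simp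
    then show "iter_derived K m M = {}"
      using iter_derived_mono[OF that(2), where K = K and n = m] that(3) unfolding T_def by blast
  qed
  have "\<exists>V W. openin K V \<and> openin K W \<and> y \<in> V \<and> T \<subseteq> W \<and> disjnt V W"
    if "y \<in> K derived_set_of L - T" for y
    using Hausdorff_separate_point_compact[OF K(2), of T y] that T closedin_subset[OF L(1)]
      derived_set_of_subset_topspace[of K L]
    by (metis DiffE finite_imp_compactin subset_iff)
  then obtain V W where VW: "\<And>y. y \<in> K derived_set_of L - T \<Longrightarrow>
    openin K (V y) \<and> openin K (W y) \<and> y \<in> V y \<and> T \<subseteq> W y \<and> disjnt (V y) (W y)"
    by metis
  \<comment> \<open>The part of \<open>L\<close> in each \<open>V y\<close> is countable, since it lies in a closed set that misses \<open>T\<close>.\<close>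
  define O1 where "O1 = (\<Union>y\<in>K derived_set_of L - T. V y)"
  have "countable (L \<inter> V y)" if y: "y \<in> K derived_set_of L - T" for y
  proof (rule countable_subset)
    show "L \<inter> V y \<subseteq> L - W y" using VW[OF y] by (auto simp: disjnt_iff)
    show "countable (L - W y)"
      by (rule small') (use VW[OF y] L(1) in \<open>auto simp: closedin_diff\<close>)
  qed
  then have "countable (\<Union>y\<in>K derived_set_of L - T. L \<inter> V y)"
    using L' by blast
  then have "countable (L \<inter> O1)" by (simp only: O1_def Int_UN_distrib)
  then have unc1: "uncountable (L - O1)"
    using L(2) by (metis Int_Diff_Un countable_Un)
  have opO: "openin K O1" unfolding O1_def using VW by blast
  have "K derived_set_of (L - O1) \<subseteq> T"
  proof
    fix z assume z: "z \<in> K derived_set_of (L - O1)"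
    have "z \<in> L - O1"
      using z derived_set_of_closedin_subset[OF closedin_diff[OF L(1) opO]] by blast
    moreover have "z \<in> K derived_set_of L"
      using z derived_set_of_mono[of "L - O1" L K] by blast
    ultimately show "z \<in> T" using VW unfolding O1_def by blast
  qed
  moreover have "T \<subseteq> topspace K" using T(2) closedin_subset[OF L(1)] by simp
  ultimately obtain x \<Delta> where D: "\<Delta> \<subseteq> L - O1" "uncountable \<Delta>" "K derived_set_of \<Delta> \<subseteq> {x}"
    using uncountable_with_single_accumulation_point[OF K(2) T(1) _ unc1] by metis
  have D': "\<Delta> \<subseteq> topspace K" using D(1) closedin_subset[OF L(1)] by blast
  have "x \<in> topspace K"
    using compact_space_imp_Bolzano_Weierstrass[OF K(1) uncountable_infinite[OF D(2)] D'] D(3)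
      derived_set_of_subset_topspace[of K \<Delta>] by auto
  moreover have "K derived_set_of (\<Delta> - {x}) \<subseteq> {x}"
    using D(3) derived_set_of_mono[of "\<Delta> - {x}" \<Delta> K] by blast
  moreover have "uncountable (\<Delta> - {x})" using D(2) by (simp add: uncountable_minus_countable)
  ultimately show thesis using D' by (intro that[of "\<Delta> - {x}" x]) auto
qed

lemma single_accumulation_point_imp_cofinite:
  assumes "compact_space K" "\<Gamma> \<subseteq> topspace K" "K derived_set_of \<Gamma> \<subseteq> {x}" "openin K V" "x \<in> V"
  shows "finite (\<Gamma> - V)"
proof (rule ccontr)
  assume "infinite (\<Gamma> - V)"
  then obtain z where z: "z \<in> K derived_set_of (\<Gamma> - V)"
    using compact_space_imp_Bolzano_Weierstrass[OF assms(1)] assms(2) by blast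
  then have "z = x" using assms(3) derived_set_of_mono[of "\<Gamma> - V" \<Gamma> K] by blast
  with z assms(4,5) show False by (auto simp: in_derived_set_of)
qed

text \<open>
The set of accumulation points of \<open>S\<close> is nonempty and, by finite height, not perfect. Near one of
its isolated points \<open>p\<close> all other points are isolated in \<open>S\<close>.
\<close>

lemma convergent_sequence_of_isolated_points:
  assumes S: "compact_space S" "Hausdorff_space S" "iter_derived S N (topspace S) = {}"
    and inf: "infinite (topspace S)"
  obtains p and x :: "nat \<Rightarrow> 'b" where "inj x" "p \<in> topspace S" "p \<notin> range x"
    "\<And>n. openin S {x n}" "S derived_set_of range x \<subseteq> {p}"
proof -
  let ?D = "S derived_set_of topspace S"
  have ne: "?D \<noteq> {}" using compact_space_imp_Bolzano_Weierstrass[OF S(1) inf] by simp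
  have "\<not> ?D \<subseteq> S derived_set_of ?D"
  proof
    assume "?D \<subseteq> S derived_set_of ?D"
    then have "?D \<subseteq> {}"
      using perfect_subset_iter_derived[of ?D S N] S(3) derived_set_of_subset_topspace[of S] by metis
    with ne show False by blast
  qed
  then obtain p where p: "p \<in> ?D" "p \<notin> S derived_set_of ?D" by blast
  then have pS: "p \<in> topspace S" using derived_set_of_subset_topspace[of S] by blast
  have "closedin S (?D - {p})"
    using p(2) closedin_derived_set_of[OF S(2)] derived_set_of_closedin_subset[of S ?D]
      derived_set_of_mono[of "?D - {p}" ?D S] derived_set_of_subset_topspace[of S]
    by (subst closedin_contains_derived_set) blast
  then have "compactin S (?D - {p})" using S(1) closedin_compact_space by blast
  then obtain V W where VW: "openin S V" "openin S W" "p \<in> V" "?D - {p} \<subseteq> W" "disjnt V W"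
    using Hausdorff_separate_point_compact[OF S(2), of "?D - {p}" p] pS by auto
  have "infinite V" 
    using p(1) VW(1,3) derived_set_of_infinite_openin[OF S(2), of "topspace S"]
    by (metis (no_types, lifting) finite_Int mem_Collect_eq)
  then have "infinite (V - {p})" by simp
  then obtain x :: "nat \<Rightarrow> 'b" where x: "inj x" "range x \<subseteq> V - {p}"
    using infinite_countable_subset by blast
  have iso: "openin S {x n}" for n
  proof -
    have "x n \<in> V" "x n \<noteq> p" using x(2) by auto
    then have "x n \<notin> ?D" using VW by (auto simp: disjnt_iff)
    with \<open>x n \<in> V\<close> show ?thesis
      using openin_subset[OF VW(1)] by (auto simp: derived_set_of_topspace)
  qed
  have "S derived_set_of range x \<subseteq> {p}"
  proof
    fix z assume z: "z \<in> S derived_set_of range x"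
    have "range x \<subseteq> topspace S" using x(2) openin_subset[OF VW(1)] by blast
    then have "z \<in> ?D" using z derived_set_of_mono[of "range x" "topspace S" S] by blast
    moreover have "z \<notin> W" using z x(2) VW(2,5) unfolding disjnt_iff by (blast dest: in_derived_set_of[THEN iffD1])
    ultimately show "z \<in> {p}" using VW(4) by blast
  qed
  then show thesis using x pS iso by (intro that[of x p]) auto
qed

section \<open>Additive functions on clopen sets\<close>

abbreviation clopenin :: "'a topology \<Rightarrow> 'a set \<Rightarrow> bool"
  where "clopenin K W \<equiv> openin K W \<and> closedin K W"

text \<open>
This takes the place of the representation of a functional on \<open>C(K)\<close>, for \<open>K\<close> scattered, by an
absolutely summable family of point masses. The induction follows the height of \<open>V\<close>: put the
finitely many points \<open>T\<close> of top height into \<open>F\<close>. If no finite \<open>F\<close> were good enough, then sets of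
large value could be chosen inside \<open>V - T\<close> one after the other, each made disjoint from the union
\<open>Z\<close> of its predecessors; this loses at most half of the value, because the induction hypothesis
applies to \<open>Z\<close>. The total variation would be infinite.
\<close>

lemma additive_small_off_finite_set:
  fixes \<mu> :: "'a set \<Rightarrow> 'v::real_normed_vector"
  assumes K: "compact_space K" "Hausdorff_space K"
    and add: "\<And>A B. clopenin K A \<Longrightarrow> clopenin K B \<Longrightarrow> disjnt A B \<Longrightarrow> \<mu> (A \<union> B) = \<mu> A + \<mu> B"
    and var: "\<And>\<W>. finite \<W> \<Longrightarrow> (\<And>W. W \<in> \<W> \<Longrightarrow> clopenin K W) \<Longrightarrow> pairwise disjnt \<W> \<Longrightarrow>
                 (\<Sum>W\<in>\<W>. norm (\<mu> W)) \<le> C"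
    and V: "clopenin K V" "V \<inter> iter_derived K n (topspace K) = {}" and e: "0 < e"
  shows "\<exists>F. finite F \<and> (\<forall>W. clopenin K W \<and> W \<subseteq> V \<and> W \<inter> F = {} \<longrightarrow> norm (\<mu> W) \<le> e)"
  using V e
proof (induction n arbitrary: V e)
  case 0
  then have "V = {}" using closedin_subset[of K V] by auto
  moreover have "\<mu> {} = 0" using add[of "{}" "{}"] by simp
  ultimately show ?case using 0 by auto
next
  case (Suc n)
  define T where "T = V \<inter> iter_derived K n (topspace K)"
  have T: "finite T"
  proof (rule closedin_no_accumulation_imp_finite[OF K(1)])
    show "closedin K T" unfolding T_def
      using Suc.prems iter_derived_closedin[OF K(2) closedin_topspace] by blast
    then have "K derived_set_of T \<subseteq> T" by (rule derived_set_of_closedin_subset)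
    moreover have "K derived_set_of T \<subseteq> iter_derived K (Suc n) (topspace K)"
      using derived_set_of_mono[of T "iter_derived K n (topspace K)" K] by (auto simp: T_def)
    ultimately show "K derived_set_of T = {}"
      using Suc.prems(2) unfolding T_def by blast
  qed
  show ?case
  proof (rule ccontr)
    assume "\<not> ?case"
    then have big: "\<exists>W. clopenin K W \<and> W \<subseteq> V \<and> W \<inter> F = {} \<and> e < norm (\<mu> W)" if "finite F" for F
      using that by (meson not_le)
    have step: "\<exists>W. clopenin K W \<and> W \<subseteq> V - T \<and> disjnt W Z \<and> e / 2 < norm (\<mu> W)"
      if Z: "clopenin K Z" "Z \<subseteq> V - T" for Z
    proof -
      have "Z \<inter> iter_derived K n (topspace K) = {}" using Z by (auto simp: T_def)
      then obtain G where G: "finite G"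
        "\<And>W. clopenin K W \<Longrightarrow> W \<subseteq> Z \<Longrightarrow> W \<inter> G = {} \<Longrightarrow> norm (\<mu> W) \<le> e / 2"
        using Suc.IH[of Z "e / 2"] Z Suc.prems(3) by (metis half_gt_zero)
      obtain W where W: "clopenin K W" "W \<subseteq> V" "W \<inter> (T \<union> G) = {}" "e < norm (\<mu> W)"
        using big[of "T \<union> G"] T G(1) by auto
      have cl: "clopenin K (W \<inter> Z)" "clopenin K (W - Z)"
        using W Z by (auto simp: openin_diff closedin_diff)
      have "\<mu> W = \<mu> (W \<inter> Z) + \<mu> (W - Z)"
        using add[OF cl] by (simp add: Int_Diff_Un Int_Diff_disjoint disjnt_def)
      then have "norm (\<mu> W) \<le> norm (\<mu> (W \<inter> Z)) + norm (\<mu> (W - Z))"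
        by (metis norm_triangle_ineq)
      moreover have "norm (\<mu> (W \<inter> Z)) \<le> e / 2" using W(3) by (intro G(2) cl) auto
      ultimately have "e / 2 < norm (\<mu> (W - Z))"
        using W(4) by linarith
      then show ?thesis using cl W by (intro exI[of _ "W - Z"]) (auto simp: disjnt_def)
    qed
    have "\<exists>\<W>. finite \<W> \<and> (\<forall>W\<in>\<W>. clopenin K W \<and> W \<subseteq> V - T) \<and> pairwise disjnt \<W> \<and>
            real k * (e / 2) \<le> (\<Sum>W\<in>\<W>. norm (\<mu> W))" for k
    proof (induction k)
      case 0
      then show ?case by (intro exI[of _ "{}"]) auto
    next
      case (Suc k)
      then obtain \<W> where \<W>: "finite \<W>" "\<forall>W\<in>\<W>. clopenin K W \<and> W \<subseteq> V - T" "pairwise disjnt \<W>"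
        "real k * (e / 2) \<le> (\<Sum>W\<in>\<W>. norm (\<mu> W))" by blast
      have "clopenin K (\<Union>\<W>)" "\<Union>\<W> \<subseteq> V - T" using \<W>(1,2) by (auto intro: closedin_Union)
      from step[OF this] obtain W where
        W: "clopenin K W" "W \<subseteq> V - T" "disjnt W (\<Union>\<W>)" "e / 2 < norm (\<mu> W)" by blast
      have "\<mu> {} = 0" using add[of "{}" "{}"] by simp
      then have "W \<noteq> {}" using W(4) \<open>0 < e\<close> by auto
      then have "W \<notin> \<W>" using W(3) by (auto simp: disjnt_def)
      then have "real (Suc k) * (e / 2) \<le> (\<Sum>W\<in>insert W \<W>. norm (\<mu> W))"
        using \<W>(1,4) W(4) by (simp add: algebra_simps)
      moreover have "pairwise disjnt (insert W \<W>)"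
        using \<W>(3) W(3) by (auto simp: pairwise_insert disjnt_sym)
      ultimately show ?case using \<W>(1,2) W(1,2) by (intro exI[of _ "insert W \<W>"]) auto
    qed
    then have "real k * (e / 2) \<le> C" for k using var by (metis order_trans)
    moreover obtain k where "C < real k * (e / 2)"
      using reals_Archimedean3[of "e / 2"] \<open>0 < e\<close> by auto
    ultimately show False by (meson not_le)
  qed
qed

text \<open>
A list codes a finite intersection of the sets \<open>U s\<close> and their complements. Given \<open>x\<close>, choose
among those that contain \<open>x\<close> one of least height \<open>h\<close> with the fewest points of top height.
Intersecting it with \<open>U s\<close>, or with the complement if \<open>x\<close> lies there, cannot lose any top point,
so every top point has the same membership pattern as \<open>x\<close>. Since the choice of a top point depends
on the list only, there are at most as many patterns as lists.
\<close>

lemma clopen_membership_patterns_coded_by_lists: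
  fixes U :: "'i \<Rightarrow> 'a set"
  assumes K: "compact_space K" "Hausdorff_space K" "iter_derived K N (topspace K) = {}"
    and U: "\<And>s. clopenin K (U s)"
  shows "\<exists>\<tau> :: ('i \<times> bool) list \<Rightarrow> 'a. \<forall>x\<in>topspace K. \<exists>l. \<forall>s. x \<in> U s \<longleftrightarrow> \<tau> l \<in> U s"
proof -
  define cell where "cell l = topspace K \<inter> (\<Inter>(s, b)\<in>set l. if b then U s else topspace K - U s)"
    for l :: "('i \<times> bool) list"
  have cell_Cons: "cell ((s, b) # l) = cell l \<inter> (if b then U s else topspace K - U s)" for s b l
    by (auto simp: cell_def)
  have closed: "closedin K (cell l)" for l
  proof (induction l)
    case Nil
    then show ?case by (simp add: cell_def)
  next
    case (Cons a l)
    then show ?case using U by (cases a) (auto simp: cell_Cons intro!: closedin_Int closedin_diff)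
  qed
  define D where "D n = iter_derived K n (topspace K)" for n
  define h where "h l = (LEAST n. cell l \<inter> D n = {})" for l
  \<comment> \<open>A nonempty cell meets \<open>D (h l - 1)\<close> but not \<open>D (h l)\<close>, so its top is finite and nonempty.\<close>
  define top where "top l = cell l \<inter> D (h l - 1)" for l
  have h: "cell l \<inter> D (h l) = {}" for l
    unfolding h_def by (rule LeastI[of _ N]) (simp add: D_def K(3))
  have h_le: "h l \<le> n" if "cell l \<inter> D n = {}" for l n
    unfolding h_def using that by (rule Least_le)
  have h_pos: "h l \<noteq> 0" if "x \<in> cell l" for x l
  proof
    assume "h l = 0"
    with h[of l] have "cell l \<inter> topspace K = {}" by (simp add: D_def)
    with that show False by (auto simp: cell_def)
  qed
  have top_ne: "top l \<noteq> {}" if "x \<in> cell l" for x l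
  proof
    assume "top l = {}"
    then have "h l \<le> h l - 1" by (intro h_le) (simp add: top_def)
    with h_pos[OF that] show False by simp
  qed
  have top_fin: "finite (top l)" if "x \<in> cell l" for x l
  proof (rule closedin_no_accumulation_imp_finite[OF K(1)])
    show "closedin K (top l)" unfolding top_def D_def
      using closed iter_derived_closedin[OF K(2) closedin_topspace] by blast
    then have "K derived_set_of top l \<subseteq> cell l"
      using derived_set_of_closedin_subset unfolding top_def by blast
    moreover have "K derived_set_of top l \<subseteq> K derived_set_of D (h l - 1)"
      by (intro derived_set_of_mono) (auto simp: top_def)
    moreover have "K derived_set_of D (h l - 1) = D (h l)"
      using h_pos[OF that] by (cases "h l") (simp_all add: D_def)
    ultimately show "K derived_set_of top l = {}" using h[of l] by blast
  qed
  have "\<exists>l. \<forall>s. x \<in> U s \<longleftrightarrow> (SOME t. t \<in> top l) \<in> U s" if x: "x \<in> topspace K" for x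
  proof -
    have "x \<in> cell []" using x by (simp add: cell_def)
    then obtain l1 where l1: "x \<in> cell l1" "\<And>l. x \<in> cell l \<Longrightarrow> h l1 \<le> h l"
      using ex_has_least_nat[of "\<lambda>l. x \<in> cell l" "[]" h] by blast
    then obtain l where l: "x \<in> cell l" "h l = h l1"
      "\<And>l'. x \<in> cell l' \<Longrightarrow> h l' = h l1 \<Longrightarrow> card (top l) \<le> card (top l')"
      using ex_has_least_nat[of "\<lambda>l. x \<in> cell l \<and> h l = h l1" l1 "\<lambda>l. card (top l)"] by blast
    have t: "(SOME t. t \<in> top l) \<in> top l" using top_ne[OF l(1)] some_in_eq by blast
    have "x \<in> U s \<longleftrightarrow> (SOME t. t \<in> top l) \<in> U s" for s
    proof -
      \<comment> \<open>Refine the chosen cell by the side of \<open>U s\<close> on which \<open>x\<close> lies.\<close>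
      define l' where "l' = (s, x \<in> U s) # l"
      have x': "x \<in> cell l'" using l(1) x by (simp add: l'_def cell_Cons)
      have sub: "cell l' \<subseteq> cell l" by (auto simp: l'_def cell_Cons)
      have "cell l' \<inter> D (h l1) = {}" using h[of l] sub l(2) by auto
      then have hl': "h l' = h l1" using l1(2)[OF x'] h_le by (simp add: le_antisym)
      have "top l' \<subseteq> top l" using sub hl' l(2) by (auto simp: top_def)
      then have "top l' = top l"
        using l(3)[OF x' hl'] top_fin[OF l(1)] by (simp add: card_seteq)
      then have "(SOME t. t \<in> top l) \<in> cell l'" using t by (auto simp: top_def)
      then show ?thesis by (auto simp: l'_def cell_Cons split: if_splits)
    qed
    then show ?thesis by blast
  qed
  then show ?thesis by (intro exI[of _ "\<lambda>l. SOME t. t \<in> top l"]) blast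
qed

section \<open>Counting\<close>

text \<open>
The next four lemmas bound the number of records in the counting argument by the continuum.
\<close>

lemma ex_inj_seq_Cantor:
  assumes "inj (f :: 'x \<Rightarrow> nat \<Rightarrow> bool)"
  shows "\<exists>g :: (nat \<Rightarrow> 'x) \<Rightarrow> nat \<Rightarrow> bool. inj g"
proof (intro exI injI ext)
  fix u v :: "nat \<Rightarrow> 'x" and n
  let ?g = "\<lambda>(u :: nat \<Rightarrow> 'x) k. f (u (fst (prod_decode k))) (snd (prod_decode k))"
  assume eq: "?g u = ?g v"
  have "f (u n) m = f (v n) m" for m
    using fun_cong[OF eq, of "prod_encode (n, m)"] by simp
  then show "u n = v n" by (intro injD[OF assms] ext)
qed

lemma ex_inj_prod_Cantor:
  assumes "inj (f :: 'x \<Rightarrow> nat \<Rightarrow> bool)" "inj (g :: 'y \<Rightarrow> nat \<Rightarrow> bool)"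
  shows "\<exists>h :: 'x \<times> 'y \<Rightarrow> nat \<Rightarrow> bool. inj h"
proof (intro exI injI)
  fix u v :: "'x \<times> 'y"
  let ?h = "\<lambda>(u :: 'x \<times> 'y) k. case sum_decode k of Inl i \<Rightarrow> f (fst u) i | Inr i \<Rightarrow> g (snd u) i"
  assume eq: "?h u = ?h v"
  have "f (fst u) i = f (fst v) i" "g (snd u) i = g (snd v) i" for i
    using fun_cong[OF eq, of "sum_encode (Inl i)"] fun_cong[OF eq, of "sum_encode (Inr i)"] by simp_all
  then show "u = v" by (intro prod_eqI injD[OF assms(1)] injD[OF assms(2)] ext)
qed

lemma ex_inj_list_Cantor:
  assumes "inj (f :: 'x \<Rightarrow> nat \<Rightarrow> bool)"
  shows "\<exists>g :: 'x list \<Rightarrow> nat \<Rightarrow> bool. inj g"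
proof -
  obtain a :: "(nat \<Rightarrow> 'x) \<Rightarrow> nat \<Rightarrow> bool" where "inj a" using ex_inj_seq_Cantor[OF assms] by blast
  moreover have "inj (\<lambda>(n::nat) m. n = m)" by (auto intro!: injI dest: fun_cong)
  ultimately obtain b :: "nat \<times> (nat \<Rightarrow> 'x) \<Rightarrow> nat \<Rightarrow> bool" where b: "inj b"
    using ex_inj_prod_Cantor by blast
  let ?c = "\<lambda>l :: 'x list. (length l, \<lambda>i. if i < length l then l ! i else undefined)"
  have "inj ?c"
  proof (rule injI)
    fix l l' assume eq: "?c l = ?c l'"
    then have "l ! i = l' ! i" if "i < length l" for i
      using that arg_cong[OF eq, of fst] arg_cong[OF eq, of "\<lambda>q. snd q i"] by simp
    with eq show "l = l'" by (simp add: nth_equalityI)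
  qed
  with b have "inj (b \<circ> ?c)" by (rule inj_compose)
  then show ?thesis by blast
qed

lemma ex_inj_countable_sets_Cantor: "\<exists>f :: 'x::countable set \<Rightarrow> nat \<Rightarrow> bool. inj f"
proof -
  have "inj (\<lambda>(A :: 'x set) n. n \<in> to_nat ` A)"
  proof (rule injI)
    fix A B :: "'x set"
    assume eq: "(\<lambda>n. n \<in> to_nat ` A) = (\<lambda>n. n \<in> to_nat ` B)"
    have "x \<in> A \<longleftrightarrow> x \<in> B" for x using fun_cong[OF eq, of "to_nat x"] by (auto simp: image_iff)
    then show "A = B" by blast
  qed
  then show ?thesis by blast
qed

text \<open>
The functions \<open>\<mu> E n\<close> select \<open>E\<close> in the sense that their values at \<open>U s\<close> are large for almost all
\<open>n \<in> A s\<close> if \<open>s \<in> E\<close>, and small for almost all \<open>n\<close> otherwise. For each \<open>n\<close>, it is enough to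
record a list of codes for the exceptional finite set of \<open>\<mu> E n\<close> together with the traces on it of
those \<open>U s\<close> that have a large value: sets with the same trace have values that differ by at most
\<open>1/4\<close>, the gap between large and small. From these records \<open>E\<close> can be decoded, but there are only
continuum many of them.
\<close>

lemma clopen_functionals_cannot_select_all_subsets:
  fixes U :: "(nat \<Rightarrow> bool) \<Rightarrow> 'a set" and A :: "(nat \<Rightarrow> bool) \<Rightarrow> nat set"
    and \<mu> :: "(nat \<Rightarrow> bool) set \<Rightarrow> nat \<Rightarrow> 'a set \<Rightarrow> 'v::real_normed_vector"
  assumes K: "compact_space K" "Hausdorff_space K" "iter_derived K N (topspace K) = {}"
    and U: "\<And>s. clopenin K (U s)"
    and A: "\<And>s. infinite (A s)"
    and add: "\<And>E n V W. clopenin K V \<Longrightarrow> clopenin K W \<Longrightarrow> disjnt V W \<Longrightarrow>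
                \<mu> E n (V \<union> W) = \<mu> E n V + \<mu> E n W"
    and var: "\<And>E n \<W>. finite \<W> \<Longrightarrow> (\<And>W. W \<in> \<W> \<Longrightarrow> clopenin K W) \<Longrightarrow> pairwise disjnt \<W> \<Longrightarrow>
                (\<Sum>W\<in>\<W>. norm (\<mu> E n W)) \<le> C E n"
    and in_E: "\<And>E s. s \<in> E \<Longrightarrow> finite {n\<in>A s. norm (\<mu> E n (U s)) \<le> 1/2}"
    and notin_E: "\<And>E s. s \<notin> E \<Longrightarrow> finite {n. 1/4 < norm (\<mu> E n (U s))}"
  shows False
proof -
  obtain \<tau> :: "((nat \<Rightarrow> bool) \<times> bool) list \<Rightarrow> 'a"
    where \<tau>: "\<And>x. x \<in> topspace K \<Longrightarrow> \<exists>l. \<forall>s. x \<in> U s \<longleftrightarrow> \<tau> l \<in> U s"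
    using clopen_membership_patterns_coded_by_lists[where U = U, OF K U] by blast
  define trace where "trace L s = map (\<lambda>l. \<tau> l \<in> U s) L" for L s
  define decode where "decode d = {s. infinite {n \<in> A s. trace (fst (d n)) s \<in> snd (d n)}}"
    for d :: "nat \<Rightarrow> ((nat \<Rightarrow> bool) \<times> bool) list list \<times> bool list set"
  have "\<exists>d. decode d = E" for E
  proof -
    have "\<forall>n. \<exists>L. \<forall>W. clopenin K W \<and> (\<forall>x\<in>W. \<forall>l\<in>set L. \<exists>s. \<not> (x \<in> U s \<longleftrightarrow> \<tau> l \<in> U s)) \<longrightarrow>
            norm (\<mu> E n W) \<le> 1/8"
    proof
      fix n
      have "\<exists>F. finite F \<and>
          (\<forall>W. clopenin K W \<and> W \<subseteq> topspace K \<and> W \<inter> F = {} \<longrightarrow> norm (\<mu> E n W) \<le> 1/8)"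
        by (rule additive_small_off_finite_set[where C = "C E n" and n = N, OF K(1,2) add var])
          (use K(3) in auto)
      then obtain F where F: "finite F"
        "\<And>W. clopenin K W \<Longrightarrow> W \<subseteq> topspace K \<Longrightarrow> W \<inter> F = {} \<Longrightarrow> norm (\<mu> E n W) \<le> 1/8"
        by blast
      define c where "c x = (SOME l. \<forall>s. x \<in> U s \<longleftrightarrow> \<tau> l \<in> U s)" for x
      have c: "\<forall>s. x \<in> U s \<longleftrightarrow> \<tau> (c x) \<in> U s" if "x \<in> topspace K" for x
        unfolding c_def using \<tau>[OF that] by (rule someI_ex)
      from finite_list[OF finite_imageI[OF F(1)]] obtain L where L: "set L = c ` F" ..
      have "norm (\<mu> E n W) \<le> 1/8"
        if W: "clopenin K W" "\<forall>x\<in>W. \<forall>l\<in>set L. \<exists>s. \<not> (x \<in> U s \<longleftrightarrow> \<tau> l \<in> U s)" for W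
      proof (rule F(2)[OF W(1)])
        show "W \<subseteq> topspace K" using W(1) by (simp add: openin_subset)
        then show "W \<inter> F = {}" using W(2) c unfolding L by blast
      qed
      then show "\<exists>L. \<forall>W. clopenin K W \<and> (\<forall>x\<in>W. \<forall>l\<in>set L. \<exists>s. \<not> (x \<in> U s \<longleftrightarrow> \<tau> l \<in> U s)) \<longrightarrow>
            norm (\<mu> E n W) \<le> 1/8" by blast
    qed
    then obtain L where L0: "\<forall>n. \<forall>W. clopenin K W \<and>
        (\<forall>x\<in>W. \<forall>l\<in>set (L n). \<exists>s. \<not> (x \<in> U s \<longleftrightarrow> \<tau> l \<in> U s)) \<longrightarrow> norm (\<mu> E n W) \<le> 1/8"
      by (subst (asm) choice_iff) blast
    have L: "norm (\<mu> E n W) \<le> 1/8" if "clopenin K W"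
      "\<And>x l. x \<in> W \<Longrightarrow> l \<in> set (L n) \<Longrightarrow> \<exists>s. \<not> (x \<in> U s \<longleftrightarrow> \<tau> l \<in> U s)" for n W
      using L0 that by blast
    have close: "norm (\<mu> E n (U s')) \<le> norm (\<mu> E n (U s)) + 1/4"
      if "trace (L n) s = trace (L n) s'" for n s s'
    proof -
      have same: "\<tau> l \<in> U s \<longleftrightarrow> \<tau> l \<in> U s'" if "l \<in> set (L n)" for l
        using that \<open>trace (L n) s = trace (L n) s'\<close> by (auto simp: trace_def)
      have cl: "clopenin K (U s - U s')" "clopenin K (U s' - U s)"
        using U by (auto simp: openin_diff closedin_diff)
      have 1: "norm (\<mu> E n (U s - U s')) \<le> 1/8" "norm (\<mu> E n (U s' - U s)) \<le> 1/8"
        using same by (intro L cl; blast)+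
      have split: "\<mu> E n V = \<mu> E n (V - W) + \<mu> E n (V \<inter> W)" if "clopenin K V" "clopenin K W" for V W
      proof -
        have "\<mu> E n ((V - W) \<union> (V \<inter> W)) = \<mu> E n (V - W) + \<mu> E n (V \<inter> W)"
          using that by (intro add) (auto simp: openin_diff closedin_diff disjnt_def)
        moreover have "(V - W) \<union> (V \<inter> W) = V" by blast
        ultimately show ?thesis by simp
      qed
      have 2: "\<mu> E n (U s) = \<mu> E n (U s - U s') + \<mu> E n (U s \<inter> U s')" by (intro split U)
      have 3: "\<mu> E n (U s') = \<mu> E n (U s' - U s) + \<mu> E n (U s \<inter> U s')"
        using split[of "U s'" "U s"] U by (simp add: Int_commute)
      have "\<mu> E n (U s') = \<mu> E n (U s) + (\<mu> E n (U s' - U s) - \<mu> E n (U s - U s'))"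
        using 2 3 by simp
      then have "norm (\<mu> E n (U s')) \<le> norm (\<mu> E n (U s)) + norm (\<mu> E n (U s' - U s) - \<mu> E n (U s - U s'))"
        by (metis norm_triangle_ineq)
      with 1 norm_triangle_ineq4[of "\<mu> E n (U s' - U s)" "\<mu> E n (U s - U s')"] show ?thesis
        by linarith
    qed
    define d where "d n = (L n, trace (L n) ` {s. 1/2 < norm (\<mu> E n (U s))})" for n
    have "s \<in> decode d \<longleftrightarrow> s \<in> E" for s
    proof
      assume s: "s \<in> E"
      have "A s - {n\<in>A s. norm (\<mu> E n (U s)) \<le> 1/2} \<subseteq> {n \<in> A s. trace (fst (d n)) s \<in> snd (d n)}"
        by (auto simp: d_def)
      moreover have "infinite (A s - {n\<in>A s. norm (\<mu> E n (U s)) \<le> 1/2})"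
        using A in_E[OF s] by (rule Diff_infinite_finite[rotated])
      ultimately show "s \<in> decode d"
        unfolding decode_def using infinite_super by blast
    next
      assume s: "s \<in> decode d"
      show "s \<in> E"
      proof (rule ccontr)
        assume "s \<notin> E"
        have "{n \<in> A s. trace (fst (d n)) s \<in> snd (d n)} \<subseteq> {n. 1/4 < norm (\<mu> E n (U s))}"
        proof clarify
          fix n assume "trace (fst (d n)) s \<in> snd (d n)"
          then obtain s' where "1/2 < norm (\<mu> E n (U s'))" "trace (L n) s = trace (L n) s'"
            by (auto simp: d_def)
          with close[of n s s'] show "1/4 < norm (\<mu> E n (U s))" by linarith
        qed
        with notin_E[OF \<open>s \<notin> E\<close>] s show False
          unfolding decode_def using finite_subset by blast
      qed
    qed
    then show ?thesis by blast
  qed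
  then obtain d where d: "\<And>E. decode (d E) = E" by metis
  have "\<exists>f :: (nat \<Rightarrow> ((nat \<Rightarrow> bool) \<times> bool) list list \<times> bool list set) \<Rightarrow> nat \<Rightarrow> bool. inj f"
  proof -
    have "inj (\<lambda>b::bool. \<lambda>n::nat. b)" by (auto intro!: injI dest: fun_cong)
    from ex_inj_prod_Cantor[OF inj_on_id this]
    obtain f1 :: "(nat \<Rightarrow> bool) \<times> bool \<Rightarrow> nat \<Rightarrow> bool" where "inj f1" by (auto simp: id_def)
    from ex_inj_list_Cantor[OF this]
    obtain f2 :: "((nat \<Rightarrow> bool) \<times> bool) list \<Rightarrow> nat \<Rightarrow> bool" where "inj f2" by blast
    from ex_inj_list_Cantor[OF this]
    obtain f3 :: "((nat \<Rightarrow> bool) \<times> bool) list list \<Rightarrow> nat \<Rightarrow> bool" where f3: "inj f3" by blast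
    obtain f4 :: "bool list set \<Rightarrow> nat \<Rightarrow> bool" where "inj f4"
      using ex_inj_countable_sets_Cantor by blast
    from ex_inj_prod_Cantor[OF f3 this] obtain f5 ::
      "((nat \<Rightarrow> bool) \<times> bool) list list \<times> bool list set \<Rightarrow> nat \<Rightarrow> bool" where "inj f5" by blast
    from ex_inj_seq_Cantor[OF this] show ?thesis .
  qed
  then obtain f :: "(nat \<Rightarrow> ((nat \<Rightarrow> bool) \<times> bool) list list \<times> bool list set) \<Rightarrow> nat \<Rightarrow> bool"
    where "inj f" by blast
  moreover have "inj d" using d by (metis injI)
  ultimately have "inj (f \<circ> d)" by (rule inj_compose)
  then have "surj (inv_into UNIV (f \<circ> d))" by (rule inj_imp_surj_inv)
  then have "inv_into UNIV (f \<circ> d) ` UNIV = Pow UNIV" by simp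
  with Cantors_theorem show False by blast
qed

section \<open>Gluing a sequence of isolated points onto a compact space\<close>

lemma C_space_norm_upper:
  fixes f :: "'a \<Rightarrow> 'k::real_normed_field"
  assumes "compact_space K" "f \<in> carrier (C_space K)" "x \<in> topspace K"
  shows "norm (f x) \<le> vnorm (C_space K) f"
proof -
  have "compactin euclidean (f ` topspace K)"
    using assms image_compactin[of K "topspace K" euclidean f] by (auto simp: compact_space_def)
  then have "bounded (f ` topspace K)" by (simp add: compact_imp_bounded)
  then have "bdd_above ((\<lambda>x. norm (f x)) ` topspace K)" by (force simp: bounded_iff bdd_above_def)
  from cSUP_upper[OF assms(3) this] show ?thesis by simp
qed

lemma C_space_norm_least:
  fixes f :: "'a \<Rightarrow> 'k::real_normed_field"
  assumes "topspace K \<noteq> {}" "\<And>x. x \<in> topspace K \<Longrightarrow> norm (f x) \<le> b"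
  shows "vnorm (C_space K) f \<le> b"
  using assms by (simp add: cSUP_least)

lemma continuous_map_euclidean_nhd:
  fixes f :: "'a \<Rightarrow> 'k::real_normed_vector"
  assumes "continuous_map K euclidean f" "0 < e"
  shows "openin K {x \<in> topspace K. norm (f x - c) < e}"
proof -
  have "openin K {x \<in> topspace K. f x \<in> ball c e}"
    by (rule openin_continuous_map_preimage[OF assms(1)]) simp
  then show ?thesis by (simp add: dist_norm norm_minus_commute)
qed

lemma compact_space_indexed_cover:
  assumes "compact_space X" "\<And>i. i \<in> I \<Longrightarrow> openin X (V i)" "topspace X \<subseteq> (\<Union>i\<in>I. V i)"
  shows "\<exists>J. finite J \<and> J \<subseteq> I \<and> topspace X \<subseteq> (\<Union>i\<in>J. V i)"
proof -
  have "(\<forall>W\<in>V ` I. openin X W) \<and> topspace X \<subseteq> \<Union>(V ` I)" using assms(2,3) by simp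
  from assms(1)[unfolded compact_space_alt, THEN spec, THEN mp, OF this] obtain \<F> where F: "finite \<F>" "\<F> \<subseteq> V ` I" "topspace X \<subseteq> \<Union>\<F>" by (elim exE conjE)
  from finite_subset_image[OF F(1,2)] obtain J where J: "J \<subseteq> I" "finite J" "\<F> = V ` J"
    by (elim bexE exE conjE)
  with F(3) show ?thesis by (intro exI[of _ J]) simp
qed

text \<open>
The isolated points \<open>y n\<close> of \<open>S\<close>, which converge to \<open>p\<close>, are the ones to be moved, and the
points \<open>g s\<close> of \<open>K\<close>, which converge to \<open>x0\<close>, are their new limits.
\<close>

locale gluing =
  fixes K :: "'a topology" and S :: "'b topology" and x0 :: 'a and g :: "'i \<Rightarrow> 'a"
    and A :: "'i \<Rightarrow> nat set" and p :: 'b and y :: "nat \<Rightarrow> 'b"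
  assumes compK: "compact_space K" and compS: "compact_space S" and hausS: "Hausdorff_space S"
    and g: "g s \<in> topspace K" and x0: "x0 \<in> topspace K"
    and g_conv: "openin K V \<Longrightarrow> x0 \<in> V \<Longrightarrow> finite {s. g s \<notin> V}"
    and A_disj: "s \<noteq> t \<Longrightarrow> finite (A s \<inter> A t)"
    and y_inj: "inj y" and y_open: "openin S {y n}"
    and p: "p \<in> topspace S" "p \<notin> range y"
    and y_acc: "S derived_set_of range y \<subseteq> {p}"
begin

lemma y_topspace: "y n \<in> topspace S"
  using openin_subset[OF y_open[of n]] by simp

lemma openin_image_y: "openin S (y ` B)"
proof -
  have "openin S (\<Union>n\<in>B. {y n})" using y_open by (intro openin_Union) auto
  moreover have "(\<Union>n\<in>B. {y n}) = y ` B" by auto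
  ultimately show ?thesis by simp
qed

lemma y_conv: "openin S V \<Longrightarrow> p \<in> V \<Longrightarrow> finite {n. y n \<notin> V}"
proof -
  assume V: "openin S V" "p \<in> V"
  have "finite (range y - V)"
    using single_accumulation_point_imp_cofinite[OF compS _ y_acc V] y_topspace by blast
  then have "finite (y -` (range y - V))" by (rule finite_vimageI) (rule y_inj)
  then show ?thesis by (rule finite_subset[rotated]) auto
qed

definition rest :: "'b topology"
  where "rest = subtopology S (- range y)"

lemma topspace_rest: "topspace rest = topspace S - range y"
  by (auto simp: rest_def)

lemma compact_rest: "compact_space rest"
proof -
  have "closedin S (topspace S - range y)" using openin_image_y by (intro closedin_diff) auto
  then have "compactin S (topspace S - range y)" by (rule closedin_compact_space[OF compS])
  then have "compact_space (subtopology S (topspace S - range y))"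
    by (rule compact_space_subtopology)
  moreover have "subtopology S (topspace S - range y) = rest"
    using subtopology_restrict[of S "- range y"] by (simp add: rest_def Diff_eq)
  ultimately show ?thesis by simp
qed

text \<open>
Since the \<open>y n\<close> are isolated and accumulate only at \<open>p\<close>, they restrict the continuity of a
function at no point other than \<open>p\<close>.
\<close>

lemma continuous_map_S_iff:
  fixes u :: "'b \<Rightarrow> 'k::real_normed_vector"
  shows "continuous_map S euclidean u \<longleftrightarrow>
    continuous_map rest euclidean u \<and> (\<forall>e>0. finite {n. e \<le> norm (u (y n) - u p)})"
    (is "?l \<longleftrightarrow> ?r")
proof
  assume u: ?l
  have "finite {n. e \<le> norm (u (y n) - u p)}" if "e > 0" for e
    using y_conv[OF continuous_map_euclidean_nhd[OF u that, of "u p"]] p that y_topspace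
    by (simp add: not_less)
  then show ?r using u unfolding rest_def by (simp add: continuous_map_from_subtopology)
next
  assume r: ?r
  show ?l
    unfolding continuous_map_def
  proof (intro conjI allI impI)
    fix O1 :: "'k set" assume O1: "openin euclidean O1"
    have "openin rest {x \<in> topspace rest. u x \<in> O1}"
      using r O1 by (auto intro: openin_continuous_map_preimage)
    then obtain G where G: "openin S G" "{x \<in> topspace rest. u x \<in> O1} = G \<inter> - range y"
      by (auto simp: rest_def openin_subtopology)
    show "openin S {x \<in> topspace S. u x \<in> O1}"
    proof (cases "u p \<in> O1")
      case True
      then obtain e where e: "e > 0" "ball (u p) e \<subseteq> O1"
        using O1 by (auto simp: open_contains_ball)
      let ?B = "{n. u (y n) \<notin> O1}"
      have "?B \<subseteq> {n. e \<le> norm (u (y n) - u p)}"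
      proof
        fix n assume "n \<in> ?B"
        then have "u (y n) \<notin> ball (u p) e" using e(2) by blast
        then show "n \<in> {n. e \<le> norm (u (y n) - u p)}"
          by (simp add: dist_norm norm_minus_commute not_less)
      qed
      moreover have "finite {n. e \<le> norm (u (y n) - u p)}" using r e(1) by simp
      ultimately have "finite ?B" by (rule finite_subset)
      then have "closedin S (y ` ?B)"
        using y_topspace by (intro closedin_Hausdorff_finite[OF hausS]) auto
      then have "openin S ((G - y ` ?B) \<union> y ` (- ?B))" using G(1) openin_image_y by (intro openin_Un openin_diff)
      moreover have "{x \<in> topspace S. u x \<in> O1} = (G - y ` ?B) \<union> y ` (- ?B)"
      proof (rule Set.set_eqI)
        fix x
        show "x \<in> {x \<in> topspace S. u x \<in> O1} \<longleftrightarrow> x \<in> (G - y ` ?B) \<union> y ` (- ?B)"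
        proof (cases "x \<in> range y")
          case True
          then show ?thesis using y_topspace y_inj by (auto dest: injD)
        next
          case False
          then have "x \<in> G \<longleftrightarrow> x \<in> topspace S \<and> u x \<in> O1" using G(2) by (auto simp: topspace_rest)
          then show ?thesis using False by auto
        qed
      qed
      ultimately show ?thesis by simp
    next
      case False
      then have "p \<notin> G" using G(2) p by blast
      have "closedin S (insert p (range y))"
      proof (subst closedin_contains_derived_set, intro conjI)
        have "S derived_set_of insert p (range y) = S derived_set_of {p} \<union> S derived_set_of range y"
          using derived_set_of_Un[of S "{p}" "range y"] by simp
        then show "S derived_set_of insert p (range y) \<subseteq> insert p (range y)"
          using y_acc derived_set_of_singleton[OF hausS] by auto
      qed (use p y_topspace in auto)
      then have "openin S ((G - insert p (range y)) \<union> y ` {n. u (y n) \<in> O1})"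
        using G(1) openin_image_y by (intro openin_Un openin_diff)
      moreover have "{x \<in> topspace S. u x \<in> O1} = (G - insert p (range y)) \<union> y ` {n. u (y n) \<in> O1}"
      proof (rule Set.set_eqI)
        fix x
        show "x \<in> {x \<in> topspace S. u x \<in> O1} \<longleftrightarrow>
              x \<in> (G - insert p (range y)) \<union> y ` {n. u (y n) \<in> O1}"
        proof (cases "x \<in> range y")
          case True
          then show ?thesis using y_topspace y_inj by (auto dest: injD)
        next
          case nr: False
          then have "x \<in> G \<longleftrightarrow> x \<in> topspace S \<and> u x \<in> O1" using G(2) by (auto simp: topspace_rest)
          then show ?thesis using nr False by auto
        qed
      qed
      ultimately show ?thesis by simp
    qed
  qed auto
qed

text \<open>
The glued space is \<open>K\<close> together with \<open>S\<close>, where the points \<open>y n\<close> are still isolated but have left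
\<open>p\<close>: those with index in \<open>A s\<close> for some \<open>s \<in> E\<close> converge to \<open>g s\<close>, and the last condition
makes the remaining ones converge to \<open>x0\<close>. It has to exempt finitely many of the sets \<open>A s\<close>,
because a neighbourhood of \<open>x0\<close> misses finitely many of the points \<open>g s\<close>.
\<close>

definition glued_open :: "'i set \<Rightarrow> ('a + 'b) set \<Rightarrow> bool"
  where "glued_open E W \<longleftrightarrow>
    W \<subseteq> Inl ` topspace K \<union> Inr ` topspace S \<and> openin K (Inl -` W) \<and>
    openin rest (Inr -` W - range y) \<and>
    (\<forall>s\<in>E. Inl (g s) \<in> W \<longrightarrow> finite {n\<in>A s. Inr (y n) \<notin> W}) \<and>
    (Inl x0 \<in> W \<longrightarrow> (\<exists>P\<subseteq>E. finite P \<and> finite {n. Inr (y n) \<notin> W \<and> n \<notin> \<Union>(A ` P)}))"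

definition glued :: "'i set \<Rightarrow> ('a + 'b) topology"
  where "glued E = topology (glued_open E)"

lemma istopology_glued_open: "istopology (glued_open E)"
  unfolding istopology_def
proof (intro conjI allI impI)
  fix V W assume V: "glued_open E V" and W: "glued_open E W"
  show "glued_open E (V \<inter> W)"
    unfolding glued_open_def
  proof (intro conjI ballI impI)
    show "V \<inter> W \<subseteq> Inl ` topspace K \<union> Inr ` topspace S" using V by (auto simp: glued_open_def)
    show "openin K (Inl -` (V \<inter> W))" using V W by (simp add: glued_open_def openin_Int)
    have "openin rest ((Inr -` V - range y) \<inter> (Inr -` W - range y))"
      using V W by (simp add: glued_open_def openin_Int)
    then show "openin rest (Inr -` (V \<inter> W) - range y)"
      by (rule back_subst[of "openin rest"]) auto
    fix s assume s: "s \<in> E" "Inl (g s) \<in> V \<inter> W"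
    have "finite ({n\<in>A s. Inr (y n) \<notin> V} \<union> {n\<in>A s. Inr (y n) \<notin> W})"
      using V W s by (simp add: glued_open_def)
    then show "finite {n\<in>A s. Inr (y n) \<notin> V \<inter> W}" by (rule finite_subset[rotated]) auto
  next
    assume x: "Inl x0 \<in> V \<inter> W"
    obtain P where P: "P \<subseteq> E" "finite P" "finite {n. Inr (y n) \<notin> V \<and> n \<notin> \<Union>(A ` P)}"
      using V x by (auto simp: glued_open_def)
    obtain Q where Q: "Q \<subseteq> E" "finite Q" "finite {n. Inr (y n) \<notin> W \<and> n \<notin> \<Union>(A ` Q)}"
      using W x by (auto simp: glued_open_def)
    have "finite {n. Inr (y n) \<notin> V \<inter> W \<and> n \<notin> \<Union>(A ` (P \<union> Q))}"
      by (rule finite_subset[OF _ finite_UnI[OF P(3) Q(3)]]) auto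
    then show "\<exists>P\<subseteq>E. finite P \<and> finite {n. Inr (y n) \<notin> V \<inter> W \<and> n \<notin> \<Union>(A ` P)}"
      using P Q by (intro exI[of _ "P \<union> Q"]) auto
  qed
next
  fix \<W> assume \<W>: "\<forall>W\<in>\<W>. glued_open E W"
  show "glued_open E (\<Union>\<W>)"
    unfolding glued_open_def
  proof (intro conjI ballI impI)
    show "\<Union>\<W> \<subseteq> Inl ` topspace K \<union> Inr ` topspace S" using \<W> unfolding glued_open_def by blast
    have "openin K (\<Union>W\<in>\<W>. Inl -` W)" using \<W> unfolding glued_open_def by blast
    then show "openin K (Inl -` \<Union>\<W>)" by (simp add: vimage_Union)
    have "openin rest (\<Union>W\<in>\<W>. Inr -` W - range y)" using \<W> unfolding glued_open_def by blast
    then show "openin rest (Inr -` \<Union>\<W> - range y)" by (rule back_subst[of "openin rest"]) auto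
    fix s assume s: "s \<in> E" "Inl (g s) \<in> \<Union>\<W>"
    then obtain W where W: "W \<in> \<W>" "Inl (g s) \<in> W" by blast
    then have "finite {n\<in>A s. Inr (y n) \<notin> W}" using \<W> s(1) by (simp add: glued_open_def)
    then show "finite {n\<in>A s. Inr (y n) \<notin> \<Union>\<W>}" by (rule finite_subset[rotated]) (use W in auto)
  next
    assume "Inl x0 \<in> \<Union>\<W>"
    then obtain W where W: "W \<in> \<W>" "Inl x0 \<in> W" by blast
    then obtain P where P: "P \<subseteq> E" "finite P" "finite {n. Inr (y n) \<notin> W \<and> n \<notin> \<Union>(A ` P)}"
      using \<W> by (auto simp: glued_open_def)
    have "finite {n. Inr (y n) \<notin> \<Union>\<W> \<and> n \<notin> \<Union>(A ` P)}"
      by (rule finite_subset[OF _ P(3)]) (use W in auto)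
    then show "\<exists>P\<subseteq>E. finite P \<and> finite {n. Inr (y n) \<notin> \<Union>\<W> \<and> n \<notin> \<Union>(A ` P)}"
      using P by blast
  qed
qed

lemma openin_glued: "openin (glued E) = glued_open E"
  unfolding glued_def by (rule topology_inverse'[OF istopology_glued_open])

lemma topspace_glued: "topspace (glued E) = Inl ` topspace K \<union> Inr ` topspace S"
proof -
  have "Inl -` (Inl ` topspace K \<union> Inr ` topspace S :: ('a + 'b) set) = topspace K"
    "Inr -` (Inl ` topspace K \<union> Inr ` topspace S :: ('a + 'b) set) - range y = topspace rest"
    by (auto simp: topspace_rest)
  then have "glued_open E (Inl ` topspace K \<union> Inr ` topspace S)"
    unfolding glued_open_def using y_topspace by auto
  moreover have "W \<subseteq> Inl ` topspace K \<union> Inr ` topspace S" if "glued_open E W" for W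
    using that by (simp add: glued_open_def)
  ultimately show ?thesis
    unfolding topspace_def openin_glued by blast
qed

text \<open>
A finite subfamily covering \<open>K\<close> already covers all but finitely many of the points \<open>y n\<close>: its union
is a neighbourhood of \<open>x0\<close>, which takes care of the indices outside finitely many sets \<open>A s\<close> with
\<open>s \<in> E\<close>, and of the corresponding points \<open>g s\<close>.
\<close>

lemma compact_space_glued: "compact_space (glued E)"
  unfolding compact_space_alt
proof (intro allI impI)
  fix \<U> assume "(\<forall>U\<in>\<U>. openin (glued E) U) \<and> topspace (glued E) \<subseteq> \<Union>\<U>"
  then have \<U>: "\<forall>U\<in>\<U>. openin (glued E) U" "topspace (glued E) \<subseteq> \<Union>\<U>" by simp_all
  have cov: "\<And>a. a \<in> topspace K \<Longrightarrow> \<exists>U\<in>\<U>. Inl a \<in> U" "\<And>b. b \<in> topspace S \<Longrightarrow> \<exists>U\<in>\<U>. Inr b \<in> U"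
    using \<U>(2) unfolding topspace_glued by blast+
  have "topspace K \<subseteq> (\<Union>U\<in>\<U>. Inl -` U)" "topspace rest \<subseteq> (\<Union>U\<in>\<U>. Inr -` U - range y)"
    using cov by (auto simp: topspace_rest)
  moreover have "openin K (Inl -` U)" "openin rest (Inr -` U - range y)" if "U \<in> \<U>" for U
    using \<U>(1) that by (auto simp: openin_glued glued_open_def)
  ultimately obtain \<F>1 \<F>2 where F1: "finite \<F>1" "\<F>1 \<subseteq> \<U>" "topspace K \<subseteq> (\<Union>U\<in>\<F>1. Inl -` U)"
    and F2: "finite \<F>2" "\<F>2 \<subseteq> \<U>" "topspace rest \<subseteq> (\<Union>U\<in>\<F>2. Inr -` U - range y)"
    using compact_space_indexed_cover[OF compK, of \<U> "\<lambda>U. Inl -` U"]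
      compact_space_indexed_cover[OF compact_rest, of \<U> "\<lambda>U. Inr -` U - range y"] by metis
  define W where "W = \<Union>\<F>1"
  have "openin (glued E) W" unfolding W_def using F1(2) \<U>(1) by blast
  then have W: "glued_open E W" by (simp add: openin_glued)
  have KW: "Inl x \<in> W" if "x \<in> topspace K" for x using F1(3) that by (auto simp: W_def)
  obtain P where P: "P \<subseteq> E" "finite P" "finite {n. Inr (y n) \<notin> W \<and> n \<notin> \<Union>(A ` P)}"
    using W KW[OF x0] by (auto simp: glued_open_def)
  have "finite (\<Union>s\<in>P. {n\<in>A s. Inr (y n) \<notin> W})"
    using W KW[OF g] P(1,2) by (auto simp: glued_open_def)
  then have fin: "finite {n. Inr (y n) \<notin> W}"
    by (rule finite_subset[OF _ finite_UnI[OF P(3)], rotated]) auto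
  have "\<forall>n. \<exists>U. U \<in> \<U> \<and> Inr (y n) \<in> U" using cov(2)[OF y_topspace] by blast
  from choice[OF this] obtain c where c: "\<forall>n. c n \<in> \<U> \<and> Inr (y n) \<in> c n" ..
  let ?F = "\<F>1 \<union> \<F>2 \<union> c ` {n. Inr (y n) \<notin> W}"
  have "z \<in> \<Union>?F" if "z \<in> topspace (glued E)" for z
  proof (cases z)
    case (Inl a)
    then show ?thesis using that KW by (auto simp: topspace_glued W_def)
  next
    case (Inr b)
    show ?thesis
    proof (cases "b \<in> range y")
      case True
      then show ?thesis using c Inr by (auto simp: W_def)
    next
      case False
      then have "b \<in> topspace rest" using that Inr by (auto simp: topspace_glued topspace_rest)
      then show ?thesis using F2(3) Inr by auto
    qed
  qed
  then have "topspace (glued E) \<subseteq> \<Union>?F" by blast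
  moreover have "finite ?F" "?F \<subseteq> \<U>" using F1 F2 fin c by auto
  ultimately show "\<exists>\<F>. finite \<F> \<and> \<F> \<subseteq> \<U> \<and> topspace (glued E) \<subseteq> \<Union>\<F>"
    by (intro exI[of _ ?F] conjI)
qed

lemma continuous_map_glued_iff:
  fixes F :: "'a + 'b \<Rightarrow> 'k::real_normed_vector"
  shows "continuous_map (glued E) euclidean F \<longleftrightarrow>
    continuous_map K euclidean (\<lambda>a. F (Inl a)) \<and> continuous_map rest euclidean (\<lambda>b. F (Inr b)) \<and>
    (\<forall>s\<in>E. \<forall>e>0. finite {n\<in>A s. e \<le> norm (F (Inr (y n)) - F (Inl (g s)))}) \<and>
    (\<forall>e>0. \<exists>P\<subseteq>E. finite P \<and> finite {n. e \<le> norm (F (Inr (y n)) - F (Inl x0)) \<and> n \<notin> \<Union>(A ` P)})"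
    (is "?l \<longleftrightarrow> ?r")
proof
  assume F: ?l
  have pre: "glued_open E {z \<in> topspace (glued E). F z \<in> O1}" if "open O1" for O1
    using openin_continuous_map_preimage[OF F, of O1] that by (simp add: openin_glued)
  have 1: "Inl -` {z \<in> topspace (glued E). F z \<in> O1} = {a \<in> topspace K. F (Inl a) \<in> O1}"
    "Inr -` {z \<in> topspace (glued E). F z \<in> O1} - range y = {b \<in> topspace rest. F (Inr b) \<in> O1}" for O1
    by (auto simp: topspace_glued topspace_rest)
  have nb: "glued_open E {z \<in> topspace (glued E). norm (F z - c) < e}" if "e > 0" for c e
    using continuous_map_euclidean_nhd[OF F that, of c] by (simp add: openin_glued)
  show ?r
  proof (intro conjI ballI allI impI)
    have "openin K {a \<in> topspace K. F (Inl a) \<in> O1}" "openin rest {b \<in> topspace rest. F (Inr b) \<in> O1}"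
      if "open O1" for O1
      using pre[OF that] unfolding glued_open_def 1 by simp_all
    then show "continuous_map K euclidean (\<lambda>a. F (Inl a))" "continuous_map rest euclidean (\<lambda>b. F (Inr b))"
      by (simp_all add: continuous_map_def)
    fix e :: real assume e: "e > 0"
    show "finite {n\<in>A s. e \<le> norm (F (Inr (y n)) - F (Inl (g s)))}" if "s \<in> E" for s
      using nb[OF e, of "F (Inl (g s))"] that e g y_topspace
      unfolding glued_open_def by (auto simp: topspace_glued not_less image_iff)
    show "\<exists>P\<subseteq>E. finite P \<and> finite {n. e \<le> norm (F (Inr (y n)) - F (Inl x0)) \<and> n \<notin> \<Union>(A ` P)}"
      using nb[OF e, of "F (Inl x0)"] e x0 y_topspace
      unfolding glued_open_def by (auto simp: topspace_glued not_less image_iff)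
  qed
next
  assume r: ?r
  show ?l
    unfolding continuous_map_def
  proof (intro conjI allI impI)
    fix O1 :: "'k set" assume O1: "openin euclidean O1"
    let ?W = "{z \<in> topspace (glued E). F z \<in> O1}"
    have 1: "Inl -` ?W = {a \<in> topspace K. F (Inl a) \<in> O1}"
      "Inr -` ?W - range y = {b \<in> topspace rest. F (Inr b) \<in> O1}"
      by (auto simp: topspace_glued topspace_rest)
    have far: "\<exists>e>0. {n. Inr (y n) \<notin> ?W} \<subseteq> {n. e \<le> norm (F (Inr (y n)) - F z)}" if z: "z \<in> ?W" for z
    proof -
      obtain e where e: "e > 0" "ball (F z) e \<subseteq> O1"
        using O1 z by (auto simp: open_contains_ball)
      have "{n. Inr (y n) \<notin> ?W} \<subseteq> {n. e \<le> norm (F (Inr (y n)) - F z)}"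
      proof
        fix n assume "n \<in> {n. Inr (y n) \<notin> ?W}"
        then have "F (Inr (y n)) \<notin> ball (F z) e" using y_topspace e(2) by (auto simp: topspace_glued)
        then show "n \<in> {n. e \<le> norm (F (Inr (y n)) - F z)}"
          by (simp add: dist_norm norm_minus_commute not_less)
      qed
      with e(1) show ?thesis by blast
    qed
    have "glued_open E ?W"
      unfolding glued_open_def 1
    proof (intro conjI ballI impI)
      show "?W \<subseteq> Inl ` topspace K \<union> Inr ` topspace S" by (auto simp: topspace_glued)
      show "openin K {a \<in> topspace K. F (Inl a) \<in> O1}" "openin rest {b \<in> topspace rest. F (Inr b) \<in> O1}"
        using r O1 by (auto intro: openin_continuous_map_preimage)
      show "finite {n \<in> A s. Inr (y n) \<notin> ?W}" if s: "s \<in> E" "Inl (g s) \<in> ?W" for s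
      proof -
        obtain e where e: "e > 0" "{n. Inr (y n) \<notin> ?W} \<subseteq> {n. e \<le> norm (F (Inr (y n)) - F (Inl (g s)))}"
          using far[OF s(2)] by blast
        have "finite {n\<in>A s. e \<le> norm (F (Inr (y n)) - F (Inl (g s)))}" using r s(1) e(1) by blast
        then show ?thesis by (rule finite_subset[rotated]) (use e(2) in blast)
      qed
      assume x: "Inl x0 \<in> ?W"
      obtain e where e: "e > 0" "{n. Inr (y n) \<notin> ?W} \<subseteq> {n. e \<le> norm (F (Inr (y n)) - F (Inl x0))}"
        using far[OF x] by blast
      obtain P where P: "P \<subseteq> E" "finite P"
          "finite {n. e \<le> norm (F (Inr (y n)) - F (Inl x0)) \<and> n \<notin> \<Union>(A ` P)}"
        using r e(1) by blast
      have "finite {n. Inr (y n) \<notin> ?W \<and> n \<notin> \<Union>(A ` P)}"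
        by (rule finite_subset[OF _ P(3)]) (use e(2) in blast)
      with P show "\<exists>P\<subseteq>E. finite P \<and> finite {n. Inr (y n) \<notin> ?W \<and> n \<notin> \<Union>(A ` P)}" by blast
    qed
    then show "openin (glued E) ?W" by (simp add: openin_glued)
  qed auto
qed

end

section \<open>The exact sequence of a gluing\<close>

context gluing
begin

text \<open>
On the copy of \<open>c_0\<close> spanned by the points \<open>y n\<close> this is the identity; the value at \<open>p\<close> is
subtracted because in the glued space the points \<open>y n\<close> no longer converge to \<open>p\<close> but to points of
\<open>K\<close>, where the image vanishes.
\<close>

definition embed :: "'i set \<Rightarrow> ('b \<Rightarrow> 'k::real_normed_field) \<Rightarrow> 'a + 'b \<Rightarrow> 'k"
  where "embed E u = (\<lambda>z\<in>topspace (glued E). case z of Inl a \<Rightarrow> 0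
           | Inr b \<Rightarrow> if b \<in> range y then u b - u p else u b)"

definition restr :: "('a + 'b \<Rightarrow> 'k::real_normed_field) \<Rightarrow> 'a \<Rightarrow> 'k"
  where "restr F = (\<lambda>a\<in>topspace K. F (Inl a))"

lemma embed_simps:
  "a \<in> topspace K \<Longrightarrow> embed E u (Inl a) = 0"
  "embed E u (Inr (y n)) = u (y n) - u p"
  "b \<in> topspace rest \<Longrightarrow> embed E u (Inr b) = u b"
  using y_topspace by (auto simp: embed_def topspace_glued topspace_rest)

lemma restr_apply: "a \<in> topspace K \<Longrightarrow> restr F a = F (Inl a)"
  by (simp add: restr_def)

text \<open>
Outside finitely many sets \<open>A s\<close> with \<open>s \<in> E\<close> the values are close to \<open>F (Inl x0)\<close>, and on each of
these they are close to \<open>F (Inl (g s))\<close>.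
\<close>

lemma tendsto_zero_along_y:
  fixes F :: "'a + 'b \<Rightarrow> 'k::real_normed_vector"
  assumes F: "continuous_map (glued E) euclidean F" and F0: "F (Inl x0) = 0" "\<And>s. s \<in> E \<Longrightarrow> F (Inl (g s)) = 0"
    and e: "e > 0"
  shows "finite {n. e \<le> norm (F (Inr (y n)))}"
proof -
  obtain P where P: "P \<subseteq> E" "finite P" "finite {n. e \<le> norm (F (Inr (y n)) - F (Inl x0)) \<and> n \<notin> \<Union>(A ` P)}"
    using F e unfolding continuous_map_glued_iff by blast
  have "finite {n\<in>A s. e \<le> norm (F (Inr (y n)) - F (Inl (g s)))}" if "s \<in> P" for s
    using F e that P(1) unfolding continuous_map_glued_iff by blast
  then have "finite (\<Union>s\<in>P. {n\<in>A s. e \<le> norm (F (Inr (y n)) - F (Inl (g s)))})"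
    using P(2) by blast
  moreover have "F (Inl (g s)) = 0" if "s \<in> P" for s using that F0(2) P(1) by blast
  ultimately have "finite (\<Union>s\<in>P. {n\<in>A s. e \<le> norm (F (Inr (y n)))})" by simp
  from finite_UnI[OF P(3) this] show ?thesis
    by (rule finite_subset[rotated]) (use F0(1) in auto)
qed

lemma embed_in_carrier:
  fixes u :: "'b \<Rightarrow> 'k::real_normed_field"
  assumes "u \<in> carrier (C_space S)"
  shows "embed E u \<in> carrier (C_space (glued E))"
proof -
  have u: "continuous_map rest euclidean u" "\<And>e. e > 0 \<Longrightarrow> finite {n. e \<le> norm (u (y n) - u p)}"
    using assms by (auto simp: continuous_map_S_iff)
  have "continuous_map (glued E) euclidean (embed E u)"
    unfolding continuous_map_glued_iff embed_simps
  proof (intro conjI ballI allI impI)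
    show "continuous_map K euclidean (\<lambda>a. embed E u (Inl a))"
      by (rule continuous_map_eq[of K euclidean "\<lambda>_. 0"]) (simp_all add: embed_simps)
    show "continuous_map rest euclidean (\<lambda>b. embed E u (Inr b))"
      by (rule continuous_map_eq[OF u(1)]) (simp add: embed_simps)
    show "finite {n \<in> A s. e \<le> norm (u (y n) - u p - embed E u (Inl (g s)))}" if "0 < e" for s e
      by (rule finite_subset[OF _ u(2)[OF that]]) (auto simp: embed_simps g)
    show "\<exists>P\<subseteq>E. finite P \<and> finite {n. e \<le> norm (u (y n) - u p - embed E u (Inl x0)) \<and> n \<notin> \<Union>(A ` P)}"
      if "0 < e" for e
      by (intro exI[of _ "{}"]) (simp add: embed_simps x0 u(2)[OF that])
  qed
  then show ?thesis by (simp add: embed_def)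
qed

lemma kernel_restr_subset:
  fixes F :: "'a + 'b \<Rightarrow> 'k::real_normed_field"
  assumes F: "F \<in> carrier (C_space (glued E))" and F0: "\<And>a. a \<in> topspace K \<Longrightarrow> F (Inl a) = 0"
  shows "F \<in> embed E ` carrier (C_space S)"
proof -
  have cF: "continuous_map (glued E) euclidean F" using F by simp
  \<comment> \<open>Undo the subtraction of the value at \<open>p\<close> in the definition of \<open>embed\<close>.\<close>
  define u where "u = (\<lambda>b\<in>topspace S. if b \<in> range y then F (Inr b) + F (Inr p) else F (Inr b))"
  have up: "u p = F (Inr p)" using p by (simp add: u_def)
  have uy: "u (y n) = F (Inr (y n)) + F (Inr p)" for n using y_topspace by (simp add: u_def)
  have "continuous_map rest euclidean (\<lambda>b. F (Inr b))" using cF by (simp add: continuous_map_glued_iff)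
  then have "continuous_map rest euclidean u"
    by (rule continuous_map_eq) (auto simp: u_def topspace_rest)
  moreover have "finite {n. e \<le> norm (u (y n) - u p)}" if "e > 0" for e
    using tendsto_zero_along_y[OF cF _ _ that] F0 x0 g by (simp add: up uy)
  ultimately have "u \<in> carrier (C_space S)" by (simp add: continuous_map_S_iff) (simp add: u_def)
  moreover have "embed E u = F"
  proof
    fix z
    show "embed E u z = F z"
    proof (cases "z \<in> topspace (glued E)")
      case False
      then show ?thesis using F by (simp add: embed_def extensional_def)
    next
      case True
      then show ?thesis using F0 up uy by (cases z) (auto simp: embed_def topspace_glued u_def)
    qed
  qed
  ultimately show ?thesis by blast
qed

text \<open>
An extension has to satisfy infinitely many conditions at once, since \<open>y n\<close> should have almost the
value \<open>f (g s)\<close> for every \<open>s \<in> E\<close> with \<open>n \<in> A s\<close> and \<open>n\<close> large. Give \<open>y n\<close> the value \<open>f (g s)\<close>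
for one such \<open>s\<close> at which it is farthest from \<open>f x0\<close>, and \<open>f x0\<close> if there is none. This works
because only finitely many indices \<open>t\<close> have \<open>f (g t)\<close> far from \<open>f x0\<close>, and each of them can
supersede \<open>s\<close> only on the finite set \<open>A s \<inter> A t\<close>.
\<close>

lemma exists_extension:
  fixes f :: "'a \<Rightarrow> 'k::real_normed_field"
  assumes f: "f \<in> carrier (C_space K)"
  shows "\<exists>F\<in>carrier (C_space (glued E)). restr F = f \<and> vnorm (C_space (glued E)) F \<le> vnorm (C_space K) f"
proof -
  define h where "h s = f (g s) - f x0" for s
  have fin: "finite {s. e \<le> norm (h s)}" if "e > 0" for e
  proof -
    have "openin K {a \<in> topspace K. norm (f a - f x0) < e}"
      using f that by (intro continuous_map_euclidean_nhd) simp_all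
    from g_conv[OF this] show ?thesis using x0 that g by (simp add: h_def not_less)
  qed
  have "\<exists>m. {s\<in>E. n \<in> A s} \<noteq> {} \<longrightarrow> m \<in> {s\<in>E. n \<in> A s} \<and> (\<forall>s\<in>{s\<in>E. n \<in> A s}. norm (h s) \<le> norm (h m))" for n
  proof (cases "\<forall>s\<in>{s\<in>E. n \<in> A s}. h s = 0")
    case True
    then show ?thesis by (auto intro!: exI[of _ "SOME s. s \<in> E \<and> n \<in> A s"] intro: someI2)
  next
    case False
    then obtain t where t: "t \<in> E" "n \<in> A t" "h t \<noteq> 0" by blast
    let ?T = "{s\<in>E. n \<in> A s \<and> norm (h t) \<le> norm (h s)}"
    have "finite ?T" by (rule finite_subset[OF _ fin[of "norm (h t)"]]) (use t in auto)
    moreover have "?T \<noteq> {}" using t by blast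
    ultimately obtain m where m: "m \<in> ?T" "\<And>s. s \<in> ?T \<Longrightarrow> norm (h s) \<le> norm (h m)"
      using obtains_MAX[of ?T "\<lambda>s. norm (h s)"] by (metis (mono_tags, lifting) Max_ge finite_imageI imageI)
    have "norm (h s) \<le> norm (h m)" if "s \<in> E" "n \<in> A s" for s
    proof (cases "norm (h t) \<le> norm (h s)")
      case True
      then show ?thesis using m(2) that by blast
    next
      case False
      then show ?thesis using m(1) by simp
    qed
    then show ?thesis using m(1) by blast
  qed
  from choice[OF allI[OF this]] obtain m where m:
    "\<forall>n. {s\<in>E. n \<in> A s} \<noteq> {} \<longrightarrow> m n \<in> {s\<in>E. n \<in> A s} \<and> (\<forall>s\<in>{s\<in>E. n \<in> A s}. norm (h s) \<le> norm (h (m n)))" ..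
  define a where "a n = (if {s\<in>E. n \<in> A s} = {} then x0 else g (m n))" for n
  have a_K: "a n \<in> topspace K" for n using g x0 by (simp add: a_def)
  define F0 where "F0 z = (case z of Inl b \<Rightarrow> f b
      | Inr b \<Rightarrow> if b \<in> range y then f (a (inv_into UNIV y b)) else 0)" for z
  define F where "F = restrict F0 (topspace (glued E))"
  have F0: "F0 (Inl b) = f b" "F0 (Inr (y n)) = f (a n)" for b n
    using y_inj by (simp_all add: F0_def)
  have "continuous_map (glued E) euclidean F0"
    unfolding continuous_map_glued_iff F0
  proof (intro conjI ballI allI impI)
    show "continuous_map K euclidean (\<lambda>b. f b)" using f by simp
    show "continuous_map rest euclidean (\<lambda>b. F0 (Inr b))"
      by (rule continuous_map_eq[of rest euclidean "\<lambda>_. 0"]) (auto simp: F0_def topspace_rest)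
    fix e :: real assume e: "0 < e"
    show "finite {n \<in> A s. e \<le> norm (f (a n) - f (g s))}" if s: "s \<in> E" for s
    proof -
      \<comment> \<open>Only an index \<open>t\<close> with \<open>d \<le> norm (h t)\<close> can supersede \<open>s\<close> and spoil the estimate.\<close>
      define d where "d = (if h s = 0 then e else norm (h s))"
      have "d > 0" using e by (simp add: d_def)
      have "finite (\<Union>t\<in>{t. d \<le> norm (h t)} - {s}. A s \<inter> A t)"
        using fin[OF \<open>d > 0\<close>] A_disj by (intro finite_UN_I) auto
      moreover have "{n \<in> A s. e \<le> norm (f (a n) - f (g s))} \<subseteq> (\<Union>t\<in>{t. d \<le> norm (h t)} - {s}. A s \<inter> A t)"
      proof
        fix n assume n: "n \<in> {n \<in> A s. e \<le> norm (f (a n) - f (g s))}"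
        then have ne: "{s\<in>E. n \<in> A s} \<noteq> {}" using s by blast
        then have mn: "m n \<in> E" "n \<in> A (m n)" "norm (h s) \<le> norm (h (m n))" "a n = g (m n)"
          using m n s by (auto simp: a_def)
        have "m n \<noteq> s" using n e mn(4) by auto
        moreover have "d \<le> norm (h (m n))"
          using mn(3,4) n by (auto simp: d_def h_def)
        ultimately show "n \<in> (\<Union>t\<in>{t. d \<le> norm (h t)} - {s}. A s \<inter> A t)" using mn(2) n by blast
      qed
      ultimately show ?thesis by (rule rev_finite_subset)
    qed
    let ?P = "{s\<in>E. e \<le> norm (h s)}"
    have empty: "{n. e \<le> norm (f (a n) - f x0) \<and> n \<notin> \<Union>(A ` ?P)} = {}"
    proof (rule equals0I)
      fix n assume n: "n \<in> {n. e \<le> norm (f (a n) - f x0) \<and> n \<notin> \<Union>(A ` ?P)}"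
      then have "{s\<in>E. n \<in> A s} \<noteq> {}" using e by (auto simp: a_def split: if_splits)
      then have "m n \<in> E" "n \<in> A (m n)" "a n = g (m n)" using m by (auto simp: a_def)
      with n show False by (auto simp: h_def)
    qed
    have "finite ?P" by (rule finite_subset[OF _ fin[OF e]]) auto
    moreover have "finite {n. e \<le> norm (f (a n) - f x0) \<and> n \<notin> \<Union>(A ` ?P)}"
      unfolding empty by (rule finite.emptyI)
    ultimately show "\<exists>P\<subseteq>E. finite P \<and> finite {n. e \<le> norm (f (a n) - f x0) \<and> n \<notin> \<Union>(A ` P)}"
      by (intro exI[of _ ?P] conjI) blast
  qed
  then have "F \<in> carrier (C_space (glued E))" by (simp add: F_def)
  moreover have "restr F = f"
    using f by (auto simp: restr_def F_def F0 topspace_glued extensional_def fun_eq_iff)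
  moreover have "vnorm (C_space (glued E)) F \<le> vnorm (C_space K) f"
  proof (rule C_space_norm_least)
    show "topspace (glued E) \<noteq> {}" using x0 by (auto simp: topspace_glued)
    fix z assume z: "z \<in> topspace (glued E)"
    have nn: "norm (f b) \<le> vnorm (C_space K) f" if "b \<in> topspace K" for b
      by (rule C_space_norm_upper[OF compK f that])
    have "0 \<le> vnorm (C_space K) f" using nn[OF x0] norm_ge_zero order_trans by blast
    moreover have "norm (F0 z) \<le> vnorm (C_space K) f \<or> F0 z = 0"
      using z nn a_K by (cases z) (auto simp: F0_def topspace_glued)
    ultimately show "norm (F z) \<le> vnorm (C_space K) f" using z by (auto simp: F_def simp del: C_space_simps)
  qed
  ultimately show ?thesis by blast
qed

lemma short_exact_glued:
  "short_exact (C_space S :: ('k::{real_normed_field, banach}, 'b \<Rightarrow> 'k) normed_module)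
     (C_space (glued E)) (C_space K) (embed E) restr"
  unfolding short_exact_def
proof (intro conjI)
  have neT: "topspace (glued E) \<noteq> {}" using x0 by (auto simp: topspace_glued)
  show "banach_space (C_space S :: ('k, 'b \<Rightarrow> 'k) normed_module)"
    using compS p by (intro banach_space_C_space) auto
  show "banach_space (C_space (glued E) :: ('k, 'a + 'b \<Rightarrow> 'k) normed_module)"
    using compact_space_glued neT by (intro banach_space_C_space)
  show "banach_space (C_space K :: ('k, 'a \<Rightarrow> 'k) normed_module)"
    using compK x0 by (intro banach_space_C_space) auto
  show "bounded_operator (C_space S) (C_space (glued E)) (embed E :: ('b \<Rightarrow> 'k) \<Rightarrow> _)"
    unfolding bounded_operator_def
  proof (intro conjI ballI allI)
    show "embed E \<in> carrier (C_space S) \<rightarrow> carrier (C_space (glued E) :: ('k, _) normed_module)"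
      using embed_in_carrier by blast
    fix u :: "'b \<Rightarrow> 'k" assume "u \<in> carrier (C_space S)"
    show "embed E (u \<oplus>\<^bsub>C_space S\<^esub> v) = embed E u \<oplus>\<^bsub>C_space (glued E)\<^esub> embed E v" for v
      using y_topspace p by (auto simp: embed_def topspace_glued fun_eq_iff)
    show "embed E (c \<odot>\<^bsub>C_space S\<^esub> u) = c \<odot>\<^bsub>C_space (glued E)\<^esub> embed E u" for c
      using y_topspace p by (auto simp: embed_def topspace_glued fun_eq_iff algebra_simps)
  next
    have "vnorm (C_space (glued E)) (embed E u) \<le> 2 * vnorm (C_space S) u"
      if u: "u \<in> carrier (C_space S)" for u :: "'b \<Rightarrow> 'k"
    proof (rule C_space_norm_least[OF neT])
      fix z assume z: "z \<in> topspace (glued E)"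
      have nn: "norm (u b) \<le> vnorm (C_space S) u" if "b \<in> topspace S" for b
        by (rule C_space_norm_upper[OF compS u that])
      have n0: "0 \<le> vnorm (C_space S) u" using nn[OF p(1)] norm_ge_zero order_trans by blast
      show "norm (embed E u z) \<le> 2 * vnorm (C_space S) u"
      proof (cases z)
        case (Inl a)
        then show ?thesis using z n0 by (simp add: embed_def del: C_space_simps)
      next
        case (Inr b)
        then have b: "b \<in> topspace S" using z by (auto simp: topspace_glued)
        have "norm (u b - u p) \<le> 2 * vnorm (C_space S) u"
          using nn[OF b] nn[OF p(1)] norm_triangle_ineq4[of "u b" "u p"] by linarith
        then show ?thesis using z Inr nn[OF b] n0 by (auto simp: embed_def simp del: C_space_simps)
      qed
    qed
    then show "\<exists>B. \<forall>u\<in>carrier (C_space S). vnorm (C_space (glued E)) (embed E u :: _ \<Rightarrow> 'k) \<le> B * vnorm (C_space S) u"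
      by blast
  qed
  show "bounded_operator (C_space (glued E)) (C_space K) (restr :: _ \<Rightarrow> 'a \<Rightarrow> 'k)"
    unfolding bounded_operator_def
  proof (intro conjI ballI allI)
    show "restr \<in> carrier (C_space (glued E) :: ('k, _) normed_module) \<rightarrow> carrier (C_space K)"
      by (auto simp: restr_def continuous_map_glued_iff)
    fix F :: "'a + 'b \<Rightarrow> 'k"
    show "restr (F \<oplus>\<^bsub>C_space (glued E)\<^esub> G) = restr F \<oplus>\<^bsub>C_space K\<^esub> restr G" for G
      by (auto simp: restr_def topspace_glued fun_eq_iff)
    show "restr (c \<odot>\<^bsub>C_space (glued E)\<^esub> F) = c \<odot>\<^bsub>C_space K\<^esub> restr F" for c
      by (auto simp: restr_def topspace_glued fun_eq_iff)
  next
    have "vnorm (C_space K) (restr F) \<le> 1 * vnorm (C_space (glued E)) F"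
      if F: "F \<in> carrier (C_space (glued E))" for F :: "'a + 'b \<Rightarrow> 'k"
    proof (rule C_space_norm_least)
      show "topspace K \<noteq> {}" using x0 by blast
      fix a assume a: "a \<in> topspace K"
      then have "norm (F (Inl a)) \<le> vnorm (C_space (glued E)) F"
        by (intro C_space_norm_upper[OF compact_space_glued F]) (simp add: topspace_glued)
      then show "norm (restr F a) \<le> 1 * vnorm (C_space (glued E)) F"
        using a by (simp add: restr_apply del: C_space_simps)
    qed
    then show "\<exists>B. \<forall>F\<in>carrier (C_space (glued E)). vnorm (C_space K) (restr F :: _ \<Rightarrow> 'k) \<le> B * vnorm (C_space (glued E)) F"
      by blast
  qed
  have "u = \<zero>\<^bsub>C_space S\<^esub>" if u: "u \<in> carrier (C_space S)" and e: "embed E u = \<zero>\<^bsub>C_space (glued E)\<^esub>"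
    for u :: "'b \<Rightarrow> 'k"
  proof -
    have z: "embed E u (Inr b) = 0" if "b \<in> topspace S" for b
      using e that by (simp add: topspace_glued)
    have rest0: "u b = 0" if "b \<in> topspace rest" for b
      using z[of b] that by (simp add: embed_simps) (simp add: topspace_rest)
    have "u p = 0" using rest0 p by (simp add: topspace_rest)
    then have "u (y n) = 0" for n using z[OF y_topspace, of n] by (simp add: embed_simps)
    with rest0 have "u b = 0" if "b \<in> topspace S" for b
      using that by (cases "b \<in> range y") (auto simp: topspace_rest)
    with u show ?thesis by (auto simp: extensional_def fun_eq_iff)
  qed
  moreover have "embed E \<zero>\<^bsub>C_space S\<^esub> = (\<zero>\<^bsub>C_space (glued E)\<^esub> :: _ \<Rightarrow> 'k)"
    using y_topspace p by (auto simp: embed_def topspace_glued fun_eq_iff)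
  ultimately show "a_kernel (C_space S) (C_space (glued E)) (embed E) = {\<zero>\<^bsub>C_space S :: ('k, _) normed_module\<^esub>}"
    unfolding a_kernel_def' by auto
  show "a_kernel (C_space (glued E)) (C_space K) restr =
      embed E ` carrier (C_space S :: ('k, _) normed_module)"
  proof
    show "a_kernel (C_space (glued E)) (C_space K) restr \<subseteq> embed E ` carrier (C_space S :: ('k, _) normed_module)"
    proof
      fix F :: "'a + 'b \<Rightarrow> 'k" assume "F \<in> a_kernel (C_space (glued E)) (C_space K) restr"
      then have F: "F \<in> carrier (C_space (glued E))" "restr F = \<zero>\<^bsub>C_space K\<^esub>"
        unfolding a_kernel_def' by blast+
      have "F (Inl a) = 0" if "a \<in> topspace K" for a
        using fun_cong[OF F(2), of a] that by (simp add: restr_apply)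
      with F(1) show "F \<in> embed E ` carrier (C_space S)" by (rule kernel_restr_subset)
    qed
    show "embed E ` carrier (C_space S :: ('k, _) normed_module) \<subseteq> a_kernel (C_space (glued E)) (C_space K) restr"
    proof
      fix F assume "F \<in> embed E ` carrier (C_space S :: ('k, _) normed_module)"
      then obtain u where u: "u \<in> carrier (C_space S :: ('k, _) normed_module)" "F = embed E u" by blast
      have "restr F = \<zero>\<^bsub>C_space K\<^esub>" unfolding u(2) restr_def
        by (auto simp: embed_simps intro!: restrict_ext)
      with embed_in_carrier[OF u(1)] show "F \<in> a_kernel (C_space (glued E)) (C_space K) restr"
        unfolding a_kernel_def' u(2) by blast
    qed
  qed
  show "carrier (C_space K) = restr ` carrier (C_space (glued E) :: ('k, _) normed_module)"
  proof
    show "carrier (C_space K) \<subseteq> restr ` carrier (C_space (glued E) :: ('k, _) normed_module)"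
      using exists_extension by blast
    show "restr ` carrier (C_space (glued E) :: ('k, _) normed_module) \<subseteq> carrier (C_space K)"
      by (auto simp: restr_def continuous_map_glued_iff)
  qed
qed

end

section \<open>Splittings give sequences of functionals\<close>

context gluing
begin

text \<open>
What a splitting of the exact sequence leaves behind on \<open>C(K)\<close>: a uniformly bounded sequence of
functionals that recognizes the members of \<open>E\<close>.
\<close>

definition selecting_functionals ::
    "'i set \<Rightarrow> (nat \<Rightarrow> ('a \<Rightarrow> 'k::real_normed_field) \<Rightarrow> 'k) \<Rightarrow> real \<Rightarrow> bool"
  where "selecting_functionals E \<phi> C \<longleftrightarrow> 0 \<le> C \<and>
    (\<forall>n. \<forall>f\<in>carrier (C_space K). \<forall>h\<in>carrier (C_space K).
       \<phi> n (f \<oplus>\<^bsub>C_space K\<^esub> h) = \<phi> n f + \<phi> n h) \<and>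
    (\<forall>n c. \<forall>f\<in>carrier (C_space K). \<phi> n (c \<odot>\<^bsub>C_space K\<^esub> f) = c * \<phi> n f) \<and>
    (\<forall>n. \<forall>f\<in>carrier (C_space K). norm (\<phi> n f) \<le> C * vnorm (C_space K) f) \<and>
    (\<forall>f\<in>carrier (C_space K). \<forall>s\<in>E. \<forall>e>0. finite {n \<in> A s. e \<le> norm (\<phi> n f - f (g s))}) \<and>
    (\<forall>f\<in>carrier (C_space K). f x0 = 0 \<longrightarrow> (\<forall>s\<in>E. f (g s) = 0) \<longrightarrow>
       (\<forall>e>0. finite {n. e \<le> norm (\<phi> n f)}))"

text \<open>
With \<open>P\<close> the projection, \<open>F - P F\<close> depends only on the restriction of \<open>F\<close> to \<open>K\<close>, as \<open>P\<close> fixes the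
kernel of the restriction map. Evaluating it at \<open>y n\<close>, for \<open>F\<close> an extension of \<open>f\<close>, is therefore
linear in \<open>f\<close>. The term \<open>P F\<close> is an embedded function and so tends to \<open>0\<close> along \<open>y\<close>; hence the
functionals have the same limits as the values of \<open>F\<close>.
\<close>

lemma splitting_yields_functionals:
  assumes "complemented (C_space (glued E) :: ('k::{real_normed_field, banach}, _) normed_module)
             (embed E ` carrier (C_space S))"
  shows "\<exists>(\<phi> :: nat \<Rightarrow> ('a \<Rightarrow> 'k) \<Rightarrow> 'k) C. selecting_functionals E \<phi> C"
proof -
  let ?CS = "C_space S :: ('k, 'b \<Rightarrow> 'k) normed_module"
  let ?CK = "C_space K :: ('k, 'a \<Rightarrow> 'k) normed_module"
  let ?CT = "C_space (glued E) :: ('k, 'a + 'b \<Rightarrow> 'k) normed_module"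
  obtain P where P: "bounded_operator ?CT ?CT P" "\<forall>F\<in>carrier ?CT. P (P F) = P F"
    "P ` carrier ?CT = embed E ` carrier ?CS"
    using assms unfolding complemented_def by (elim exE conjE)
  note PD = P(1)[unfolded bounded_operator_def]
  have Pc: "P F \<in> carrier ?CT" if "F \<in> carrier ?CT" for F
    using conjunct1[OF PD] that by (rule funcset_mem)
  note Padd = PD[THEN conjunct2, THEN conjunct1, rule_format]
  note Pmult = PD[THEN conjunct2, THEN conjunct2, THEN conjunct1, rule_format]
  from PD[THEN conjunct2, THEN conjunct2, THEN conjunct2]
  obtain B where B: "\<forall>F\<in>carrier ?CT. vnorm ?CT (P F) \<le> B * vnorm ?CT F" ..
  interpret CK: banach_space ?CK using short_exact_glued[of E] unfolding short_exact_def by (elim conjE)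
  interpret T: banach_space ?CT using short_exact_glued[of E] unfolding short_exact_def by (elim conjE)
  have PB: "vnorm ?CT (P F) \<le> \<bar>B\<bar> * vnorm ?CT F" if "F \<in> carrier ?CT" for F
  proof -
    have "B * vnorm ?CT F \<le> \<bar>B\<bar> * vnorm ?CT F"
      using T.vnorm_nonneg[OF that] by (intro mult_right_mono) auto
    then show ?thesis using bspec[OF B that] by (rule order_trans[rotated])
  qed
  \<comment> \<open>The choice need not be linear; by \<open>\<nu>_eq\<close> below it does not influence the functionals.\<close>
  define ext where "ext f = (SOME F. F \<in> carrier ?CT \<and> restr F = f \<and> vnorm ?CT F \<le> vnorm ?CK f)" for f
  have ext: "ext f \<in> carrier ?CT" "restr (ext f) = f" "vnorm ?CT (ext f) \<le> vnorm ?CK f"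
    if f: "f \<in> carrier ?CK" for f
  proof -
    have "\<exists>F. F \<in> carrier ?CT \<and> restr F = f \<and> vnorm ?CT F \<le> vnorm ?CK f"
      using exists_extension[OF f] by blast
    from someI_ex[OF this]
    show "ext f \<in> carrier ?CT" "restr (ext f) = f" "vnorm ?CT (ext f) \<le> vnorm ?CK f"
      by (simp_all only: ext_def)
  qed
  define \<nu> where "\<nu> n F = F (Inr (y n)) - P F (Inr (y n))" for n F
  have yT: "Inr (y n) \<in> topspace (glued E)" for n using y_topspace by (simp add: topspace_glued)
  have add_at: "(F \<oplus>\<^bsub>?CT\<^esub> G) (Inr (y n)) = F (Inr (y n)) + G (Inr (y n))"
    and mult_at: "(c \<odot>\<^bsub>?CT\<^esub> F) (Inr (y n)) = c * F (Inr (y n))" for F G :: "'a + 'b \<Rightarrow> 'k" and c n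
    using yT by simp_all
  have smult: "c \<odot>\<^bsub>?CT\<^esub> F \<in> carrier ?CT" if "F \<in> carrier ?CT" for c F
    using that by (intro T.smult_closed) auto
  have \<nu>add: "\<nu> n (F \<oplus>\<^bsub>?CT\<^esub> G) = \<nu> n F + \<nu> n G" if "F \<in> carrier ?CT" "G \<in> carrier ?CT" for n F G
    unfolding \<nu>_def Padd[OF that] add_at by simp
  have \<nu>mult: "\<nu> n (c \<odot>\<^bsub>?CT\<^esub> F) = c * \<nu> n F" if "F \<in> carrier ?CT" for n c F
    unfolding \<nu>_def Pmult[OF that] mult_at by (simp add: algebra_simps)
  have \<nu>0: "\<nu> n F = 0" if F: "F \<in> carrier ?CT" "\<And>a. a \<in> topspace K \<Longrightarrow> F (Inl a) = 0" for n F
  proof -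
    have "F \<in> P ` carrier ?CT" unfolding P(3) using F by (rule kernel_restr_subset)
    then obtain G where "G \<in> carrier ?CT" "F = P G" by blast
    then have "P F = F" using P(2) by simp
    then show ?thesis by (simp add: \<nu>_def)
  qed
  have \<nu>_eq: "\<nu> n F = \<nu> n G" if FG: "F \<in> carrier ?CT" "G \<in> carrier ?CT" "restr F = restr G" for n F G
  proof -
    let ?D = "F \<oplus>\<^bsub>?CT\<^esub> (- 1) \<odot>\<^bsub>?CT\<^esub> G"
    have "F (Inl a) = G (Inl a)" if "a \<in> topspace K" for a
      using fun_cong[OF FG(3), of a] that by (simp add: restr_apply)
    then have "?D (Inl a) = 0" if "a \<in> topspace K" for a
      using that by (simp add: topspace_glued)
    moreover have "?D \<in> carrier ?CT" by (intro T.a_closed smult FG)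
    ultimately have "\<nu> n ?D = 0" by (rule \<nu>0[rotated])
    then show ?thesis
      unfolding \<nu>add[OF FG(1) smult[OF FG(2)]] \<nu>mult[OF FG(2)] by simp
  qed
  have P_lim: "finite {n. e \<le> norm (P F (Inr (y n)))}" if F: "F \<in> carrier ?CT" and e: "e > 0" for F e
  proof (rule tendsto_zero_along_y[OF _ _ _ e])
    obtain u where u: "P F = embed E u" using P(3) F by blast
    show "continuous_map (glued E) euclidean (P F)" using Pc[OF F] by simp
    show "P F (Inl x0) = 0" "P F (Inl (g s)) = 0" for s
      unfolding u using x0 g by (simp_all add: embed_simps)
  qed
  show ?thesis
    unfolding selecting_functionals_def
  proof (intro exI[of _ "\<lambda>n f. \<nu> n (ext f)"] exI[of _ "1 + \<bar>B\<bar>"] conjI allI ballI impI)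
    show "0 \<le> 1 + \<bar>B\<bar>" by simp
    fix n and f :: "'a \<Rightarrow> 'k" assume f: "f \<in> carrier ?CK"
    show "\<nu> n (ext (f \<oplus>\<^bsub>?CK\<^esub> h)) = \<nu> n (ext f) + \<nu> n (ext h)" if h: "h \<in> carrier ?CK" for h
    proof -
      have fh: "f \<oplus>\<^bsub>?CK\<^esub> h \<in> carrier ?CK" by (rule CK.a_closed[OF f h])
      have "restr (ext f \<oplus>\<^bsub>?CT\<^esub> ext h) = restr (ext f) \<oplus>\<^bsub>?CK\<^esub> restr (ext h)"
        by (auto simp: restr_def topspace_glued fun_eq_iff)
      then have "restr (ext (f \<oplus>\<^bsub>?CK\<^esub> h)) = restr (ext f \<oplus>\<^bsub>?CT\<^esub> ext h)"
        by (simp only: ext(2)[OF f] ext(2)[OF h] ext(2)[OF fh])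
      then have "\<nu> n (ext (f \<oplus>\<^bsub>?CK\<^esub> h)) = \<nu> n (ext f \<oplus>\<^bsub>?CT\<^esub> ext h)"
        by (intro \<nu>_eq ext(1) f h fh T.a_closed)
      then show ?thesis by (simp only: \<nu>add[OF ext(1)[OF f] ext(1)[OF h]])
    qed
    show "\<nu> n (ext (c \<odot>\<^bsub>?CK\<^esub> f)) = c * \<nu> n (ext f)" for c
    proof -
      have cf: "c \<odot>\<^bsub>?CK\<^esub> f \<in> carrier ?CK" using f by (intro CK.smult_closed) auto
      have "restr (c \<odot>\<^bsub>?CT\<^esub> ext f) = c \<odot>\<^bsub>?CK\<^esub> restr (ext f)"
        by (auto simp: restr_def topspace_glued fun_eq_iff)
      then have "restr (ext (c \<odot>\<^bsub>?CK\<^esub> f)) = restr (c \<odot>\<^bsub>?CT\<^esub> ext f)"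
        by (simp only: ext(2)[OF f] ext(2)[OF cf])
      then have "\<nu> n (ext (c \<odot>\<^bsub>?CK\<^esub> f)) = \<nu> n (c \<odot>\<^bsub>?CT\<^esub> ext f)"
        by (intro \<nu>_eq ext(1) f cf smult)
      then show ?thesis by (simp only: \<nu>mult[OF ext(1)[OF f]])
    qed
    have "norm (\<nu> n (ext f)) \<le> norm (ext f (Inr (y n))) + norm (P (ext f) (Inr (y n)))"
      unfolding \<nu>_def by (rule norm_triangle_ineq4)
    also have "\<dots> \<le> vnorm ?CT (ext f) + vnorm ?CT (P (ext f))"
      by (intro add_mono C_space_norm_upper compact_space_glued ext(1) Pc f yT)
    also have "\<dots> \<le> vnorm ?CT (ext f) + \<bar>B\<bar> * vnorm ?CT (ext f)"
      using PB[OF ext(1)[OF f]] by (rule add_left_mono)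
    also have "\<dots> = (1 + \<bar>B\<bar>) * vnorm ?CT (ext f)" by (simp only: distrib_right mult_1)
    also have "\<dots> \<le> (1 + \<bar>B\<bar>) * vnorm ?CK f"
      using ext(3)[OF f] by (intro mult_left_mono) auto
    finally show "norm (\<nu> n (ext f)) \<le> (1 + \<bar>B\<bar>) * vnorm ?CK f" .
  next
    fix s and f :: "'a \<Rightarrow> 'k" and e :: real
    assume f: "f \<in> carrier ?CK" and s: "s \<in> E" and e: "e > 0"
    have "e / 2 > 0" using e by simp
    have "continuous_map (glued E) euclidean (ext f)" using ext(1)[OF f] by simp
    then have "finite {n\<in>A s. e / 2 \<le> norm (ext f (Inr (y n)) - ext f (Inl (g s)))}"
      using s \<open>e / 2 > 0\<close> unfolding continuous_map_glued_iff by blast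
    from finite_UnI[OF this P_lim[OF ext(1)[OF f] \<open>e / 2 > 0\<close>]]
    show "finite {n \<in> A s. e \<le> norm (\<nu> n (ext f) - f (g s))}"
    proof (rule finite_subset[rotated], intro subsetI)
      fix n assume n: "n \<in> {n \<in> A s. e \<le> norm (\<nu> n (ext f) - f (g s))}"
      have "ext f (Inl (g s)) = f (g s)" using restr_apply[OF g, of "ext f" s] ext(2)[OF f] by simp
      then have "norm (\<nu> n (ext f) - f (g s)) \<le>
          norm (ext f (Inr (y n)) - ext f (Inl (g s))) + norm (P (ext f) (Inr (y n)))"
        using norm_triangle_ineq4[of "ext f (Inr (y n)) - ext f (Inl (g s))" "P (ext f) (Inr (y n))"]
        by (simp add: \<nu>_def algebra_simps)
      with n show "n \<in> {n\<in>A s. e / 2 \<le> norm (ext f (Inr (y n)) - ext f (Inl (g s)))} \<union>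
          {n. e / 2 \<le> norm (P (ext f) (Inr (y n)))}" by auto
    qed
  next
    fix f :: "'a \<Rightarrow> 'k" and e :: real
    assume f: "f \<in> carrier ?CK" and f0: "f x0 = 0" "\<forall>s\<in>E. f (g s) = 0" and e: "e > 0"
    have "e / 2 > 0" using e by simp
    have "finite {n. e / 2 \<le> norm (ext f (Inr (y n)))}"
    proof (rule tendsto_zero_along_y[OF _ _ _ \<open>e / 2 > 0\<close>])
      show "continuous_map (glued E) euclidean (ext f)" using ext(1)[OF f] by simp
      show "ext f (Inl x0) = 0" using restr_apply[OF x0, of "ext f"] ext(2)[OF f] f0 by simp
      show "ext f (Inl (g s)) = 0" if "s \<in> E" for s
        using restr_apply[OF g, of "ext f" s] ext(2)[OF f] f0(2) that by simp
    qed
    from finite_UnI[OF this P_lim[OF ext(1)[OF f] \<open>e / 2 > 0\<close>]]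
    show "finite {n. e \<le> norm (\<nu> n (ext f))}"
    proof (rule finite_subset[rotated], intro subsetI)
      fix n assume n: "n \<in> {n. e \<le> norm (\<nu> n (ext f))}"
      have "norm (\<nu> n (ext f)) \<le> norm (ext f (Inr (y n))) + norm (P (ext f) (Inr (y n)))"
        unfolding \<nu>_def by (rule norm_triangle_ineq4)
      with n show "n \<in> {n. e / 2 \<le> norm (ext f (Inr (y n)))} \<union> {n. e / 2 \<le> norm (P (ext f) (Inr (y n)))}"
        by auto
    qed
  qed
qed

end

section \<open>Functionals restricted to clopen sets\<close>

definition indic :: "'a topology \<Rightarrow> 'a set \<Rightarrow> 'a \<Rightarrow> 'k::real_normed_field"
  where "indic K W = (\<lambda>x\<in>topspace K. if x \<in> W then 1 else 0)"

lemma indic_in_carrier: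
  assumes "clopenin K W"
  shows "(indic K W :: 'a \<Rightarrow> 'k::real_normed_field) \<in> carrier (C_space K)"
proof -
  have "continuous_map K euclidean (\<lambda>x. if x \<in> W then 1 else 0 :: 'k)"
    unfolding continuous_map_def
  proof (intro conjI allI impI)
    fix O1 :: "'k set"
    have "{x \<in> topspace K. (if x \<in> W then 1 else 0) \<in> O1} =
        (if 1 \<in> O1 then W else {}) \<union> (if 0 \<in> O1 then topspace K - W else {})"
      using openin_subset[of K W] assms by auto
    moreover have "openin K (topspace K - W)" using assms by (simp add: openin_diff)
    moreover have "W \<union> topspace K = topspace K" using openin_subset[of K W] assms by blast
    ultimately show "openin K {x \<in> topspace K. (if x \<in> W then 1 else 0) \<in> O1}"
      using assms by simp
  qed auto
  then show ?thesis by (simp add: indic_def)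
qed

lemma indic_disjoint_Un:
  assumes "disjnt V W"
  shows "indic K (V \<union> W) = indic K V \<oplus>\<^bsub>C_space K\<^esub> indic K W"
  using assms by (auto simp: indic_def disjnt_iff fun_eq_iff)

text \<open>
Test the functional on the combination of the indicators with coefficients of modulus at most \<open>1\<close>
that turn its values into their moduli. Disjointness keeps the norm of the combination at most \<open>1\<close>.
\<close>

lemma functional_variation_on_clopens:
  fixes \<phi> :: "('a \<Rightarrow> 'k::real_normed_field) \<Rightarrow> 'k"
  assumes ne: "topspace K \<noteq> {}" and C: "0 \<le> C"
    and add: "\<And>f h. f \<in> carrier (C_space K) \<Longrightarrow> h \<in> carrier (C_space K) \<Longrightarrow>
                 \<phi> (f \<oplus>\<^bsub>C_space K\<^esub> h) = \<phi> f + \<phi> h"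
    and mult: "\<And>c f. f \<in> carrier (C_space K) \<Longrightarrow> \<phi> (c \<odot>\<^bsub>C_space K\<^esub> f) = c * \<phi> f"
    and bound: "\<And>f. f \<in> carrier (C_space K) \<Longrightarrow> norm (\<phi> f) \<le> C * vnorm (C_space K) f"
    and \<W>: "finite \<W>" "\<And>W. W \<in> \<W> \<Longrightarrow> clopenin K W" "pairwise disjnt \<W>"
  shows "(\<Sum>W\<in>\<W>. norm (\<phi> (indic K W))) \<le> C"
proof -
  interpret CK: module scalars "C_space K :: ('k, 'a \<Rightarrow> 'k) normed_module" by (rule module_C_space)
  define c where "c W = (if \<phi> (indic K W) = 0 then 0 else of_real (norm (\<phi> (indic K W))) / \<phi> (indic K W))" for W
  have c: "c W * \<phi> (indic K W) = of_real (norm (\<phi> (indic K W)))" "norm (c W) \<le> 1" for W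
    by (simp_all add: c_def norm_divide)
  define f where "f \<V> = (\<lambda>x\<in>topspace K. \<Sum>W\<in>\<V>. c W * indic K W x)" for \<V>
  have f: "f \<V> \<in> carrier (C_space K) \<and> \<phi> (f \<V>) = of_real (\<Sum>W\<in>\<V>. norm (\<phi> (indic K W)))"
    if "finite \<V>" "\<V> \<subseteq> \<W>" for \<V>
    using that
  proof (induction \<V> rule: finite_induct)
    case empty
    have z: "f {} \<in> carrier (C_space K)" by (simp add: f_def)
    have "f {} = 0 \<odot>\<^bsub>C_space K\<^esub> f {}" by (simp add: f_def)
    then have "\<phi> (f {}) = 0 * \<phi> (f {})" using mult[OF z] by metis
    with z show ?case by simp
  next
    case (insert W \<V>)
    have i: "indic K W \<in> carrier (C_space K :: ('k, _) normed_module)"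
      using insert.prems \<W>(2) by (intro indic_in_carrier) auto
    then have ci: "c W \<odot>\<^bsub>C_space K\<^esub> indic K W \<in> carrier (C_space K)"
      by (intro CK.smult_closed) auto
    have eq: "f (insert W \<V>) = c W \<odot>\<^bsub>C_space K\<^esub> indic K W \<oplus>\<^bsub>C_space K\<^esub> f \<V>"
      using insert.hyps by (auto simp: f_def fun_eq_iff)
    have IH: "f \<V> \<in> carrier (C_space K)" "\<phi> (f \<V>) = of_real (\<Sum>W\<in>\<V>. norm (\<phi> (indic K W)))"
      using insert by auto
    have "f (insert W \<V>) \<in> carrier (C_space K)"
      unfolding eq by (rule CK.a_closed[OF ci IH(1)])
    moreover have "\<phi> (f (insert W \<V>)) = of_real (\<Sum>W\<in>insert W \<V>. norm (\<phi> (indic K W)))"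
      unfolding eq add[OF ci IH(1)] mult[OF i] c(1) IH(2) using insert.hyps by simp
    ultimately show ?case by blast
  qed
  have "vnorm (C_space K) (f \<W>) \<le> 1"
  proof (rule C_space_norm_least[OF ne])
    fix x assume x: "x \<in> topspace K"
    have fx: "f \<W> x = (\<Sum>W\<in>\<W>. if x \<in> W then c W else 0)"
      using x by (auto simp: f_def indic_def intro!: sum.cong)
    show "norm (f \<W> x) \<le> 1"
    proof (cases "\<exists>V\<in>\<W>. x \<in> V")
      case True
      then obtain V where V: "V \<in> \<W>" "x \<in> V" by blast
      have "x \<notin> W" if "W \<in> \<W>" "W \<noteq> V" for W
        using \<W>(3) V that unfolding pairwise_def disjnt_iff by blast
      then have "f \<W> x = (\<Sum>W\<in>\<W>. if W = V then c W else 0)"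
        unfolding fx using V by (intro sum.cong) auto
      then show ?thesis using \<W>(1) V(1) c(2) by simp
    next
      case False
      then have "f \<W> x = 0" unfolding fx by (intro sum.neutral) auto
      then show ?thesis by simp
    qed
  qed
  then have "C * vnorm (C_space K) (f \<W>) \<le> C" using C mult_left_mono by fastforce
  moreover have "(\<Sum>W\<in>\<W>. norm (\<phi> (indic K W))) = norm (\<phi> (f \<W>))"
    using f[OF \<W>(1)] by (simp add: sum_nonneg del: of_real_sum)
  moreover have "norm (\<phi> (f \<W>)) \<le> C * vnorm (C_space K) (f \<W>)"
    using f[OF \<W>(1) order_refl] by (intro bound) blast
  ultimately show ?thesis by linarith
qed

section \<open>Index sets of size continuum\<close>

lemma continuum_hypothesis_inj_Cantor:
  assumes CH: continuum_hypothesis and unc: "uncountable \<Gamma>"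
  obtains f :: "(nat \<Rightarrow> bool) \<Rightarrow> 'a" where "inj f" "range f \<subseteq> \<Gamma>"
proof -
  have "(card_of \<Gamma>, natLeq) \<notin> ordLeq" using unc countable_card_le_natLeq by blast
  then have "(natLeq, card_of \<Gamma>) \<in> ordLess"
    using not_ordLeq_iff_ordLess[OF natLeq_Well_order card_of_Well_order] by blast
  then have "(cardSuc natLeq, card_of \<Gamma>) \<in> ordLeq"
    by (rule cardSuc_least[OF natLeq_Card_order card_of_Card_order])
  then have "(card_of (UNIV :: real set), card_of \<Gamma>) \<in> ordLeq"
    using CH ordIso_ordLeq_trans unfolding continuum_hypothesis_def by blast
  then obtain h :: "real \<Rightarrow> 'a" where h: "inj h" "range h \<subseteq> \<Gamma>"
    unfolding card_of_ordLeq[symmetric] by blast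
  obtain k :: "nat set \<Rightarrow> real" where k: "inj k"
    using nat_sets_eqpoll_reals unfolding eqpoll_def bij_betw_def by blast
  have "inj (Collect :: (nat \<Rightarrow> bool) \<Rightarrow> nat set)" by (intro injI) (rule Collect_inj)
  with h(1) k have "inj (h \<circ> k \<circ> Collect)" by (intro inj_compose)
  moreover have "range (h \<circ> k \<circ> Collect) \<subseteq> \<Gamma>" using h(2) by auto
  ultimately show thesis by (rule that)
qed

text \<open>
The branches of the binary tree form an almost disjoint family indexed by the Cantor set.
\<close>

definition branch :: "(nat \<Rightarrow> bool) \<Rightarrow> nat set"
  where "branch s = range (\<lambda>n. to_nat (map s [0..<n]))"

lemma infinite_branch: "infinite (branch s)"
proof -
  have "inj (\<lambda>n. to_nat (map s [0..<n]))"
    by (intro injI) (metis diff_zero from_nat_to_nat length_map length_upt)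
  then show ?thesis unfolding branch_def by (rule range_inj_infinite)
qed

lemma finite_branch_Int:
  assumes "s \<noteq> t"
  shows "finite (branch s \<inter> branch t)"
proof -
  obtain k where k: "s k \<noteq> t k" using assms by blast
  have "branch s \<inter> branch t \<subseteq> (\<lambda>n. to_nat (map s [0..<n])) ` {..k}"
  proof
    fix z assume "z \<in> branch s \<inter> branch t"
    then have "z \<in> branch s" "z \<in> branch t" by blast+
    then obtain m n where z: "z = to_nat (map s [0..<m])" "z = to_nat (map t [0..<n])"
      unfolding branch_def by (elim rangeE)
    then have eq: "map s [0..<m] = map t [0..<n]" by (metis from_nat_to_nat)
    then have "m = n" by (metis diff_zero length_map length_upt)
    with eq k have "m \<le> k" by (auto simp: not_le[symmetric])
    with z(1) show "z \<in> (\<lambda>n. to_nat (map s [0..<n])) ` {..k}" by blast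
  qed
  then show ?thesis by (rule finite_subset) simp
qed

section \<open>The theorem\<close>

text \<open>
The scalars have to be complete for the spaces of continuous functions to be Banach spaces.
\<close>

lemma Ext_nonzero:
  fixes K :: "'a topology" and S :: "'b topology"
  assumes CH: "continuum_hypothesis"
    and K: "compact_space K" "Hausdorff_space K" and S: "compact_space S" "Hausdorff_space S"
    and omega: "omega_derived_set K = {}" "omega_derived_set S = {}"
    and nonmetr: "\<not> metrizable_space K" and inf: "infinite (topspace S)"
  shows "\<not> Ext_zero (C_space K :: ('k::{real_normed_field, banach}, 'a \<Rightarrow> 'k) normed_module) (C_space S)"
proof
  assume Ext: "Ext_zero (C_space K :: ('k, 'a \<Rightarrow> 'k) normed_module) (C_space S)"
  obtain N where N: "iter_derived K N (topspace K) = {}" using finite_height[OF K omega(1)] .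
  obtain M where M: "iter_derived S M (topspace S) = {}" using finite_height[OF S omega(2)] .
  have "uncountable (topspace K)"
    using countable_compact_Hausdorff_metrizable[OF K] nonmetr by blast
  then obtain x0 \<Gamma> where \<Gamma>: "uncountable \<Gamma>" "\<Gamma> \<subseteq> topspace K" "x0 \<in> topspace K" "x0 \<notin> \<Gamma>"
    "K derived_set_of \<Gamma> \<subseteq> {x0}"
    using uncountable_convergent_subset[OF K N] by metis
  obtain g :: "(nat \<Rightarrow> bool) \<Rightarrow> 'a" where g_inj: "inj g" and g_range: "range g \<subseteq> \<Gamma>"
    using continuum_hypothesis_inj_Cantor[OF CH \<Gamma>(1)] .
  have gK: "g s \<in> topspace K" for s using g_range \<Gamma>(2) by blast
  have "\<exists>U. clopenin K U \<and> g s \<in> U \<and> U \<inter> (insert x0 (\<Gamma> - {g s})) = {}" for s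
  proof -
    have "K derived_set_of (insert x0 (\<Gamma> - {g s})) = K derived_set_of {x0} \<union> K derived_set_of (\<Gamma> - {g s})"
      using derived_set_of_Un[of K "{x0}" "\<Gamma> - {g s}"] by simp
    then have "K derived_set_of (insert x0 (\<Gamma> - {g s})) \<subseteq> {x0}"
      using derived_set_of_singleton[OF K(2), of x0] derived_set_of_mono[of "\<Gamma> - {g s}" \<Gamma> K] \<Gamma>(5) by simp
    then have "closedin K (insert x0 (\<Gamma> - {g s}))"
      using \<Gamma>(2,3) by (subst closedin_contains_derived_set) auto
    moreover have "g s \<notin> insert x0 (\<Gamma> - {g s})" using g_range \<Gamma>(4) by auto
    ultimately show ?thesis using finite_height_separation[OF K N _ gK[of s]] by metis
  qed
  then have "\<forall>s. \<exists>U. clopenin K U \<and> g s \<in> U \<and> U \<inter> (insert x0 (\<Gamma> - {g s})) = {}" by blast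
  from choice[OF this] obtain U where
    U: "\<forall>s. clopenin K (U s) \<and> g s \<in> U s \<and> U s \<inter> (insert x0 (\<Gamma> - {g s})) = {}" ..
  obtain p and y :: "nat \<Rightarrow> 'b" where y: "inj y" "p \<in> topspace S" "p \<notin> range y"
    "\<And>n. openin S {y n}" "S derived_set_of range y \<subseteq> {p}"
    by (rule convergent_sequence_of_isolated_points[OF S M inf]) (rule that)
  interpret gluing K S x0 g branch p y
  proof
    fix V assume V: "openin K V" "x0 \<in> V"
    have "finite (\<Gamma> - V)" by (rule single_accumulation_point_imp_cofinite[OF K(1) \<Gamma>(2,5) V])
    then have "finite (g -` (\<Gamma> - V))" by (rule finite_vimageI) (rule g_inj)
    then show "finite {s. g s \<notin> V}" by (rule finite_subset[rotated]) (use g_range in auto)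
  qed (use K S \<Gamma>(3) gK finite_branch_Int y in auto)
  have "\<forall>E. \<exists>\<phi> :: nat \<Rightarrow> ('a \<Rightarrow> 'k) \<Rightarrow> 'k. \<exists>C. selecting_functionals E \<phi> C"
    by (intro allI splitting_yields_functionals Ext_zero_imp_splits[OF Ext short_exact_glued])
  from choice[OF this] obtain \<phi> :: "(nat \<Rightarrow> bool) set \<Rightarrow> nat \<Rightarrow> ('a \<Rightarrow> 'k) \<Rightarrow> 'k"
    where "\<forall>E. \<exists>C. selecting_functionals E (\<phi> E) C" ..
  from choice[OF this] obtain C where "\<forall>E. selecting_functionals E (\<phi> E) (C E)" ..
  note sel = this[THEN spec, unfolded selecting_functionals_def]
  have C: "0 \<le> C E" for E using sel[of E] by (rule conjunct1)
  note \<phi>_add = sel[THEN conjunct2, THEN conjunct1, rule_format]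
    and \<phi>_mult = sel[THEN conjunct2, THEN conjunct2, THEN conjunct1, rule_format]
    and \<phi>_bound = sel[THEN conjunct2, THEN conjunct2, THEN conjunct2, THEN conjunct1, rule_format]
    and \<phi>_in = sel[THEN conjunct2, THEN conjunct2, THEN conjunct2, THEN conjunct2, THEN conjunct1, rule_format]
    and \<phi>_notin = sel[THEN conjunct2, THEN conjunct2, THEN conjunct2, THEN conjunct2, THEN conjunct2, rule_format]
  show False
  proof (rule clopen_functionals_cannot_select_all_subsets[where \<mu> = "\<lambda>E n W. \<phi> E n (indic K W)"
        and A = branch and C = "\<lambda>E n. C E" and U = U, OF K N])
    show "clopenin K (U s)" for s using U by blast
    show "infinite (branch s)" for s by (rule infinite_branch)
    show "\<phi> E n (indic K (V \<union> W)) = \<phi> E n (indic K V) + \<phi> E n (indic K W)"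
      if "clopenin K V" "clopenin K W" "disjnt V W" for E n V W
      unfolding indic_disjoint_Un[OF that(3)]
      by (rule \<phi>_add[OF indic_in_carrier[OF that(1)] indic_in_carrier[OF that(2)]])
    show "(\<Sum>W\<in>\<W>. norm (\<phi> E n (indic K W))) \<le> C E"
      if "finite \<W>" "\<And>W. W \<in> \<W> \<Longrightarrow> clopenin K W" "pairwise disjnt \<W>" for E n \<W>
      by (rule functional_variation_on_clopens[OF _ C \<phi>_add \<phi>_mult \<phi>_bound that]) (use \<Gamma>(3) in auto)
    have Ug: "indic K (U s) (g t) = (if s = t then 1 else 0 :: 'k)" for s t
    proof (cases "s = t")
      case True
      then show ?thesis using U gK by (simp add: indic_def)
    next
      case False
      then have "g t \<in> \<Gamma> - {g s}" using g_inj g_range by (auto dest: injD)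
      then have "g t \<notin> U s" using U by blast
      then show ?thesis using False gK by (simp add: indic_def)
    qed
    have Ux: "indic K (U s) x0 = (0 :: 'k)" for s
      using U \<Gamma>(3) by (auto simp: indic_def)
    have Uc: "indic K (U s) \<in> carrier (C_space K :: ('k, _) normed_module)" for s
      using U by (intro indic_in_carrier) blast
    show "finite {n \<in> branch s. norm (\<phi> E n (indic K (U s))) \<le> 1/2}" if s: "s \<in> E" for E s
    proof -
      have "finite {n \<in> branch s. 1/2 \<le> norm (\<phi> E n (indic K (U s)) - indic K (U s) (g s))}"
        by (rule \<phi>_in[OF Uc s]) simp
      then show ?thesis
      proof (rule finite_subset[rotated], intro subsetI)
        fix n assume n: "n \<in> {n \<in> branch s. norm (\<phi> E n (indic K (U s))) \<le> 1/2}"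
        have "norm (1 :: 'k) \<le> norm (\<phi> E n (indic K (U s))) + norm (\<phi> E n (indic K (U s)) - 1)"
          using norm_triangle_ineq4[of "\<phi> E n (indic K (U s))" "\<phi> E n (indic K (U s)) - 1"] by simp
        with n show "n \<in> {n \<in> branch s. 1/2 \<le> norm (\<phi> E n (indic K (U s)) - indic K (U s) (g s))}"
          by (simp add: Ug)
      qed
    qed
    show "finite {n. 1/4 < norm (\<phi> E n (indic K (U s)))}" if s: "s \<notin> E" for E s
    proof -
      have "indic K (U s) (g t) = (0::'k)" if "t \<in> E" for t using s that by (auto simp: Ug)
      then have "finite {n. 1/4 \<le> norm (\<phi> E n (indic K (U s)))}"
        by (intro \<phi>_notin[OF Uc Ux]) simp_all
      then show ?thesis by (rule finite_subset[rotated]) auto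
    qed
  qed
qed

theorem theorem1:
  fixes K :: "'a topology" and S :: "'b topology"
  assumes "continuum_hypothesis"
    and "compact_space K" and "Hausdorff_space K"
    and "compact_space S" and "Hausdorff_space S"
    and "omega_derived_set K = {}" and "omega_derived_set S = {}"
    and "\<not> metrizable_space K"
    and "infinite (topspace S)"
  shows "\<not> Ext_zero (C_space K :: (real, 'a \<Rightarrow> real) normed_module) (C_space S) \<and>
         \<not> Ext_zero (C_space K :: (complex, 'a \<Rightarrow> complex) normed_module) (C_space S)"
  using Ext_nonzero[OF assms] Ext_nonzero[OF assms] by blast

end
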